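(* The variety of complex $3$-dimensional $\mathfrak{perm}$ superalgebras of type $(1,2)$ has dimension $4$ and has exactly $8$ irreducible components: $\overline{\mathcal{O}(\mathrm{R}_{04}^{\alpha})},\ \overline{\mathcal{O}(\mathrm{R}_{06}^{\alpha})},\ \overline{\mathcal{O}(\mathrm{R}_{09})},\ \overline{\mathcal{O}(\mathrm{R}_{15})},\ \overline{\mathcal{O}(\mathrm{R}_{17})},\ \overline{\mathcal{O}(\mathrm{R}_{19})},\ \overline{\mathcal{O}(\mathrm{R}_{22})},\ \overline{\mathcal{O}(\mathrm{R}_{24})}$. In particular, exactly $6$ superalgebras are rigid in this variety.
   Context: All algebras are over $\mathbb{C}$. A superalgebra is a $\mathbb{Z}_2$-graded algebra $A=A_0\oplus A_1$ with $A_iA_j\subseteq A_{i+j \bmod 2}$; $|x|\in\{0,1\}$ is the degree of a homogeneous $x$. It has type $(n,m)$ if $\dim A_0=n$, $\dim A_1=m$. The associator is $(x,y,z)=(xy)z-x(yz)$. A $\mathfrak{perm}$ superalgebra is a superalgebra satisfying $(x,y,z)=0$ and $x(yz)=(-1)^{|y||z|}x(zy)$ for all homogeneous $x,y,z$. Geometric setting: fix a graded space $V=V_0\oplus V_1$ of type $(n,m)$ with a homogeneous basis. Superalgebra structures on $V$ are even bilinear maps $\mu:V\times V\to V$, identified with their structure constants; those satisfying a given family of graded polynomial identities form a Zariski-closed subset (an affine variety) of this affine space. The group $GL(V_0)\times GL(V_1)$ acts by $(g*\mu)(x,y)=g\mu(g^{-1}x,g^{-1}y)$; its orbits are the isomorphism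 classes. $\mathcal{O}(A)$ denotes the orbit of (a structure representing) $A$ and $\overline{\mathcal{O}(A)}$ its Zariski closure; for a family $A^{\alpha}$, $\overline{\mathcal{O}(A^{\alpha})}$ denotes the closure of the union of the orbits of all $A^{\alpha}$ over the admissible parameters $\alpha$. A superalgebra is rigid if its orbit is open in the variety. The dimension of the variety is the maximal dimension of its irreducible components. Superalgebras of type $(1,2)$, in basis $e_1$ (even), $f_1,f_2$ (odd), listed by nonzero products (unlisted products are zero), $\alpha\in\mathbb{C}$: $\mathrm{R}_{04}^{\alpha}$: $f_1f_2=(\alpha+1)e_1,\ f_2f_1=(\alpha-1)e_1$; $\mathrm{R}_{06}^{\alpha}$: $e_1f_1=(1+\alpha)f_2,\ f_1e_1=(1-\alpha)f_2$; $\mathrm{R}_{09}$: $e_1e_1=e_1,\ f_1e_1=f_1$; $\mathrm{R}_{15}$: $e_1e_1=e_1,\ e_1f_1=f_1,\ f_1e_1=f_1,\ f_2e_1=f_2$; $\mathrm{R}_{17}$: $e_1e_1=e_1,\ e_1f_1=f_1,\ f_1e_1=f_1$; $\mathrm{R}_{19}$: $e_1e_1=e_1$; $\mathrm{R}_{22}$: $e_1e_1=e_1,\ f_1e_1=f_1,\ f_2e_1=f_2$; $\mathrm{R}_{24}$: $e_1e_1=e_1,\ e_1f_1=f_1,\ f_1e_1=f_1,\ e_1f_2=f_2,\ f_2e_1=f_2$. *)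

theory Defs
  imports Complex_Main
begin

section \<open>Basis of V = V0 + V1 of type (1,2): e1 even, f1 f2 odd\<close>

datatype idx = E1 | F1 | F2

lemma UNIV_idx: "(UNIV :: idx set) = {E1, F1, F2}"
  using idx.exhaust by auto

instance idx :: finite
  by standard (simp add: UNIV_idx)

fun deg :: "idx \<Rightarrow> nat" where
  "deg E1 = 0" | "deg F1 = 1" | "deg F2 = 1"

type_synonym vec = "idx \<Rightarrow> complex"
(* structure constants: mu (i,j,k) = coefficient of b_k in b_i b_j *)
type_synonym sstruct = "idx \<times> idx \<times> idx \<Rightarrow> complex"
type_synonym mat = "idx \<Rightarrow> idx \<Rightarrow> complex"

inductive_set poly_fun :: "(('a \<Rightarrow> complex) \<Rightarrow> complex) set" where
  coord: "(\<lambda>x. x i) \<in> poly_fun"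
| const: "(\<lambda>x. c) \<in> poly_fun"
| add: "p \<in> poly_fun \<Longrightarrow> q \<in> poly_fun \<Longrightarrow> (\<lambda>x. p x + q x) \<in> poly_fun"
| mult: "p \<in> poly_fun \<Longrightarrow> q \<in> poly_fun \<Longrightarrow> (\<lambda>x. p x * q x) \<in> poly_fun"

definition zclosed :: "('a \<Rightarrow> complex) set \<Rightarrow> bool" where
  "zclosed S \<longleftrightarrow> (\<exists>P. P \<subseteq> poly_fun \<and> S = {x. \<forall>p\<in>P. p x = 0})"

definition zclosure :: "('a \<Rightarrow> complex) set \<Rightarrow> ('a \<Rightarrow> complex) set" where
  "zclosure A = \<Inter>{S. zclosed S \<and> A \<subseteq> S}"

definition zirred :: "('a \<Rightarrow> complex) set \<Rightarrow> bool" where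
  "zirred Z \<longleftrightarrow> zclosed Z \<and> Z \<noteq> {} \<and>
     (\<forall>A B. zclosed A \<and> zclosed B \<and> Z \<subseteq> A \<union> B \<longrightarrow> Z \<subseteq> A \<or> Z \<subseteq> B)"

definition irr_components :: "('a \<Rightarrow> complex) set \<Rightarrow> ('a \<Rightarrow> complex) set set" where
  "irr_components X = {Z. zirred Z \<and> Z \<subseteq> X \<and>
     (\<forall>W. zirred W \<and> W \<subseteq> X \<and> Z \<subseteq> W \<longrightarrow> W = Z)}"

definition krull_ge :: "('a \<Rightarrow> complex) set \<Rightarrow> nat \<Rightarrow> bool" where
  "krull_ge X n \<longleftrightarrow> (\<exists>Z :: nat \<Rightarrow> ('a \<Rightarrow> complex) set.
     (\<forall>i\<le>n. zirred (Z i) \<and> Z i \<subseteq> X) \<and> (\<forall>i<n. Z i \<subset> Z (Suc i)))"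

definition krull_dim_eq :: "('a \<Rightarrow> complex) set \<Rightarrow> nat \<Rightarrow> bool" where
  "krull_dim_eq X n \<longleftrightarrow> krull_ge X n \<and> \<not> krull_ge X (Suc n)"

definition variety_dim_eq :: "('a \<Rightarrow> complex) set \<Rightarrow> nat \<Rightarrow> bool" where
  "variety_dim_eq X d \<longleftrightarrow>
     (\<exists>C\<in>irr_components X. krull_dim_eq C d) \<and>
     (\<forall>C\<in>irr_components X. \<forall>m. krull_dim_eq C m \<longrightarrow> m \<le> d)"

definition even_struct :: "sstruct \<Rightarrow> bool" where
  "even_struct mu \<longleftrightarrow> (\<forall>i j k. mu (i,j,k) \<noteq> 0 \<longrightarrow> deg k = (deg i + deg j) mod 2)"

definition smult :: "sstruct \<Rightarrow> vec \<Rightarrow> vec \<Rightarrow> vec" where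
  "smult mu x y = (\<lambda>k. \<Sum>i\<in>UNIV. \<Sum>j\<in>UNIV. x i * y j * mu (i,j,k))"

definition homog :: "vec \<Rightarrow> nat \<Rightarrow> bool" where
  "homog x d \<longleftrightarrow> d < 2 \<and> (\<forall>i. x i \<noteq> 0 \<longrightarrow> deg i = d)"

definition perm_struct :: "sstruct \<Rightarrow> bool" where
  "perm_struct mu \<longleftrightarrow> even_struct mu \<and>
    (\<forall>x y z dx dy dz. homog x dx \<and> homog y dy \<and> homog z dz \<longrightarrow>
       smult mu (smult mu x y) z = smult mu x (smult mu y z) \<and>
       smult mu x (smult mu y z) = (\<lambda>k. (-1) ^ (dy * dz) * smult mu x (smult mu z y) k))"

definition perm_variety :: "sstruct set" where
  "perm_variety = {mu. perm_struct mu}"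

definition even_lin :: "mat \<Rightarrow> bool" where
  "even_lin g \<longleftrightarrow> (\<forall>i j. g i j \<noteq> 0 \<longrightarrow> deg i = deg j)"

definition mat_mul :: "mat \<Rightarrow> mat \<Rightarrow> mat" where
  "mat_mul g h = (\<lambda>i j. \<Sum>k\<in>UNIV. g i k * h k j)"

definition mat_id :: mat where
  "mat_id = (\<lambda>i j. if i = j then 1 else 0)"

(* (g*mu)(x,y) = g mu(g^-1 x, g^-1 y), with h = g^-1; matrices act on columns *)
definition act :: "mat \<Rightarrow> mat \<Rightarrow> sstruct \<Rightarrow> sstruct" where
  "act g h mu = (\<lambda>(i,j,k). \<Sum>p\<in>UNIV. \<Sum>q\<in>UNIV. \<Sum>r\<in>UNIV. h p i * h q j * mu (p,q,r) * g k r)"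

definition orbit :: "sstruct \<Rightarrow> sstruct set" where
  "orbit mu = {act g h mu | g h. even_lin g \<and> mat_mul g h = mat_id \<and> mat_mul h g = mat_id}"

definition rigid_in :: "sstruct set \<Rightarrow> sstruct \<Rightarrow> bool" where
  "rigid_in X mu \<longleftrightarrow> mu \<in> X \<and> (\<exists>F. zclosed F \<and> orbit mu = X - F)"

definition R04 :: "complex \<Rightarrow> sstruct" where
  "R04 a = (\<lambda>t. if t = (F1,F2,E1) then a + 1 else if t = (F2,F1,E1) then a - 1 else 0)"

definition R06 :: "complex \<Rightarrow> sstruct" where
  "R06 a = (\<lambda>t. if t = (E1,F1,F2) then 1 + a else if t = (F1,E1,F2) then 1 - a else 0)"

definition R09 :: sstruct where
  "R09 = (\<lambda>t. if t \<in> {(E1,E1,E1), (F1,E1,F1)} then 1 else 0)"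

definition R15 :: sstruct where
  "R15 = (\<lambda>t. if t \<in> {(E1,E1,E1), (E1,F1,F1), (F1,E1,F1), (F2,E1,F2)} then 1 else 0)"

definition R17 :: sstruct where
  "R17 = (\<lambda>t. if t \<in> {(E1,E1,E1), (E1,F1,F1), (F1,E1,F1)} then 1 else 0)"

definition R19 :: sstruct where
  "R19 = (\<lambda>t. if t = (E1,E1,E1) then 1 else 0)"

definition R22 :: sstruct where
  "R22 = (\<lambda>t. if t \<in> {(E1,E1,E1), (F1,E1,F1), (F2,E1,F2)} then 1 else 0)"

definition R24 :: sstruct where
  "R24 = (\<lambda>t. if t \<in> {(E1,E1,E1), (E1,F1,F1), (F1,E1,F1), (E1,F2,F2), (F2,E1,F2)} then 1 else 0)"

end

theory Submission
  imports Defs "HOL-Computational_Algebra.Polynomial" "HOL-Library.Cardinality" "HOL-Library.FuncSet"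
begin

text \<open>An even structure is a quadruple \<open>(a, L, R, B)\<close>: \<open>e e = a e\<close>, left and right multiplication
  by \<open>e\<close> on the odd part, and the form \<open>f f' = B(f, f') e\<close>. If \<open>a \<noteq> 0\<close>, the identities force
  \<open>B = 0\<close> and make \<open>L/a\<close>, \<open>R/a\<close> idempotents with \<open>L R = R L = a L\<close>, so the pair of ranks is one of
  six, each giving one orbit. If \<open>a = 0\<close>, either \<open>L = R = 0\<close> with \<open>B\<close> arbitrary, or \<open>B = 0\<close> and
  \<open>L\<close>, \<open>R\<close> are multiples of one nilpotent matrix. This covers the variety by eight closed sets; each
  is the image of a polynomial map from affine 4-space, hence irreducible of dimension at most 4, and
  none contains another. The two sets with \<open>a = 0\<close> contain no open orbit because the discriminants of
  the symmetric and skew parts of \<open>B\<close>, respectively the factors of \<open>L\<close> and \<open>R\<close>, keep their ratio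
  along an orbit.\<close>

section \<open>Zariski topology\<close>

text \<open>The dimension bound has to start from chains of irreducible closed sets. Five strict
  inclusions inside one of the eight sets would give five algebraically independent functions on it;
  pulled back along the parametrization they are five polynomials in four variables, which a count
  of monomials shows to be dependent. The value 4 is attained where \<open>B\<close> is free, by a
  flag of coordinate subspaces. Each of the eight sets is described twice: by equations, which make
  it closed, and as an image, which makes it irreducible. The image form also yields the closures:
  the locus where a nonzero polynomial does not vanish is dense in affine space, so only generic
  parameter points have to be placed in an orbit. For six sets generic means a \<noteq> 0, and one
  orbit contains all these points. For the two families, \<alpha> records the ratio of the symmetric
  to the skew part of \<open>B\<close>, or of \<open>L\<close> to \<open>R\<close>; one ratio
  corresponds to no finite \<alpha> and is reached only in the closure.\<close>

lemma poly_fun_uminus: "p \<in> poly_fun \<Longrightarrow> (\<lambda>x. - p x) \<in> poly_fun"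
  using poly_fun.mult[OF poly_fun.const[of "-1"]] by fastforce

lemma poly_fun_diff: "p \<in> poly_fun \<Longrightarrow> q \<in> poly_fun \<Longrightarrow> (\<lambda>x. p x - q x) \<in> poly_fun"
  using poly_fun.add[OF _ poly_fun_uminus] by fastforce

lemma poly_fun_power: "p \<in> poly_fun \<Longrightarrow> (\<lambda>x. p x ^ n) \<in> poly_fun"
  by (induction n) (auto intro: poly_fun.intros)

lemmas poly_fun_intros = poly_fun.intros poly_fun_uminus poly_fun_diff poly_fun_power

lemma poly_fun_comp:
  assumes "p \<in> poly_fun" and "\<And>i. (\<lambda>t. F t i) \<in> poly_fun"
  shows "(\<lambda>t. p (F t)) \<in> poly_fun"
  using assms(1) by induction (auto intro: poly_fun.intros assms(2))

lemma poly_fun_on_line: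
  assumes "p \<in> poly_fun"
  shows "\<exists>P. \<forall>c. p (\<lambda>i. a i + c * b i) = poly P c"
  using assms
proof induction
  case (coord i)
  show ?case by (rule exI[of _ "[:a i, b i:]"]) simp
next
  case (const c)
  show ?case by (rule exI[of _ "[:c:]"]) simp
next
  case (add p q)
  then show ?case by (metis poly_add)
next
  case (mult p q)
  then show ?case by (metis poly_mult)
qed

text \<open>On the line joining a point where p is nonzero to one where q is nonzero, both restrict
  to nonzero polynomials in one variable, and those have no zero divisors.\<close>

lemma poly_fun_mult_eq_0:
  assumes p: "p \<in> poly_fun" and q: "q \<in> poly_fun" and pq: "\<And>x. p x * q x = 0"
  shows "(\<forall>x. p x = 0) \<or> (\<forall>x. q x = 0)"
proof (rule ccontr)
  assume "\<not> ?thesis"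
  then obtain x y where x: "p x \<noteq> 0" and y: "q y \<noteq> 0" by auto
  obtain P where P: "\<And>c. p (\<lambda>i. x i + c * (y i - x i)) = poly P c"
    using poly_fun_on_line[OF p, of x "\<lambda>i. y i - x i"] by auto
  obtain Q where Q: "\<And>c. q (\<lambda>i. x i + c * (y i - x i)) = poly Q c"
    using poly_fun_on_line[OF q, of x "\<lambda>i. y i - x i"] by auto
  have "\<forall>c. poly (P * Q) c = 0" using pq P Q by (metis poly_mult)
  then have "P = 0 \<or> Q = 0" by (simp add: poly_all_0_iff_0 flip: poly_mult)
  with P[of 0] Q[of 1] x y show False by auto
qed

lemma zclosedE:
  assumes "zclosed S"
  obtains P where "P \<subseteq> poly_fun" and "S = {x. \<forall>p\<in>P. p x = 0}"
  using assms unfolding zclosed_def by blast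

lemma zclosed_separate:
  assumes "zclosed S" and "x \<notin> S"
  obtains p where "p \<in> poly_fun" and "\<And>y. y \<in> S \<Longrightarrow> p y = 0" and "p x \<noteq> 0"
  using assms unfolding zclosed_def by blast

lemma zclosed_eq:
  assumes "p \<in> poly_fun" and "q \<in> poly_fun"
  shows "zclosed {x. p x = q x}"
  unfolding zclosed_def
  by (rule exI[of _ "{\<lambda>x. p x - q x}"]) (auto intro: poly_fun_diff assms)

lemma zclosed_all:
  assumes "\<And>i. zclosed {x. P i x}"
  shows "zclosed {x. \<forall>i. P i x}"
proof -
  have "\<forall>i. \<exists>Q. Q \<subseteq> poly_fun \<and> {x. P i x} = {x. \<forall>p\<in>Q. p x = 0}"
    using assms unfolding zclosed_def by blast
  from choice[OF this] obtain Q where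
    Q: "\<forall>i. Q i \<subseteq> poly_fun \<and> {x. P i x} = {x. \<forall>p\<in>Q i. p x = 0}"
    by (rule exE)
  then have "(\<Union>i. Q i) \<subseteq> poly_fun" by auto
  moreover have "P i x \<longleftrightarrow> (\<forall>p\<in>Q i. p x = 0)" for i x using Q by (simp add: set_eq_iff)
  then have "{x. \<forall>i. P i x} = {x. \<forall>p\<in>(\<Union>i. Q i). p x = 0}" by simp
  ultimately show ?thesis unfolding zclosed_def by blast
qed

lemma zclosed_UNIV: "zclosed UNIV"
  using zclosed_eq[OF poly_fun.const[of 0] poly_fun.const[of 0]] by simp

lemma zclosed_empty: "zclosed {}"
  using zclosed_eq[OF poly_fun.const[of 0] poly_fun.const[of 1]] by simp

lemma zclosed_imp: "zclosed {x. P x} \<Longrightarrow> zclosed {x. c \<longrightarrow> P x}"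
  by (cases c) (auto intro: zclosed_UNIV)

lemma zclosed_conj:
  assumes "zclosed {x. P x}" and "zclosed {x. Q x}"
  shows "zclosed {x. P x \<and> Q x}"
proof -
  have "zclosed {x. if b then P x else Q x}" for b using assms by (cases b) simp_all
  then have "zclosed {x. \<forall>b. if b then P x else Q x}" by (rule zclosed_all)
  then show ?thesis by (simp add: all_bool_eq conj_commute)
qed

lemma zclosed_Un:
  assumes "zclosed A" and "zclosed B"
  shows "zclosed (A \<union> B)"
proof -
  obtain P where P: "P \<subseteq> poly_fun" "A = {x. \<forall>p\<in>P. p x = 0}" using assms(1) by (rule zclosedE)
  obtain Q where Q: "Q \<subseteq> poly_fun" "B = {x. \<forall>p\<in>Q. p x = 0}" using assms(2) by (rule zclosedE)
  let ?R = "{\<lambda>x. p x * q x | p q. p \<in> P \<and> q \<in> Q}"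
  have "?R \<subseteq> poly_fun" using P(1) Q(1) by (auto intro!: poly_fun.mult)
  moreover have "A \<union> B = {x. \<forall>r\<in>?R. r x = 0}"
  proof
    show "A \<union> B \<subseteq> {x. \<forall>r\<in>?R. r x = 0}" using P(2) Q(2) by auto
    show "{x. \<forall>r\<in>?R. r x = 0} \<subseteq> A \<union> B"
    proof
      fix x assume x: "x \<in> {x. \<forall>r\<in>?R. r x = 0}"
      have "p x * q x = 0" if "p \<in> P" "q \<in> Q" for p q using x that by fast
      then show "x \<in> A \<union> B" using P(2) Q(2) by auto
    qed
  qed
  ultimately show ?thesis unfolding zclosed_def by blast
qed

lemma zclosed_UN: "finite I \<Longrightarrow> (\<And>i. i \<in> I \<Longrightarrow> zclosed (Z i)) \<Longrightarrow> zclosed (\<Union>i\<in>I. Z i)"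
  by (induction rule: finite_induct) (auto intro: zclosed_Un zclosed_empty)

lemma zclosure_minimal: "A \<subseteq> S \<Longrightarrow> zclosed S \<Longrightarrow> zclosure A \<subseteq> S"
  unfolding zclosure_def by auto

lemma zirred_subset_UN:
  assumes "zirred W" and "finite I" and "\<And>i. i \<in> I \<Longrightarrow> zclosed (Z i)" and "W \<subseteq> (\<Union>i\<in>I. Z i)"
  shows "\<exists>i\<in>I. W \<subseteq> Z i"
  using assms(2-)
proof (induction rule: finite_induct)
  case empty
  then show ?case using assms(1) by (auto simp: zirred_def)
next
  case (insert i I)
  have "zclosed (Z i)" "zclosed (\<Union>i\<in>I. Z i)"
    using insert.hyps insert.prems by (simp_all add: zclosed_UN)
  moreover have "W \<subseteq> Z i \<union> (\<Union>i\<in>I. Z i)" using insert.prems by simp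
  ultimately have "W \<subseteq> Z i \<or> W \<subseteq> (\<Union>i\<in>I. Z i)" using assms(1) unfolding zirred_def by blast
  then show ?case
  proof
    assume "W \<subseteq> (\<Union>i\<in>I. Z i)"
    then have "\<exists>i\<in>I. W \<subseteq> Z i" using insert.IH insert.prems(1) by simp
    then show ?case by blast
  qed blast
qed

text \<open>If two closed sets cover the image but neither contains it, polynomials vanishing on
  them pull back to two nonzero polynomials on affine space with product zero.\<close>

lemma zirred_range:
  assumes F: "\<And>i. (\<lambda>t. F t i) \<in> poly_fun" and closed: "zclosed (range F)"
  shows "zirred (range F)"
  unfolding zirred_def
proof (intro conjI allI impI)
  show "zclosed (range F)" by fact
  show "range F \<noteq> {}" by simp
  fix A B assume AB: "zclosed A \<and> zclosed B \<and> range F \<subseteq> A \<union> B"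
  show "range F \<subseteq> A \<or> range F \<subseteq> B"
  proof (rule ccontr)
    assume "\<not> ?thesis"
    then obtain s t where s: "F s \<notin> A" and t: "F t \<notin> B" by auto
    obtain p where p: "p \<in> poly_fun" "\<And>y. y \<in> A \<Longrightarrow> p y = 0" "p (F s) \<noteq> 0"
      using AB s zclosed_separate by metis
    obtain q where q: "q \<in> poly_fun" "\<And>y. y \<in> B \<Longrightarrow> q y = 0" "q (F t) \<noteq> 0"
      using AB t zclosed_separate by metis
    have AB: "F u \<in> A \<or> F u \<in> B" for u using AB by auto
    have "p (F u) * q (F u) = 0" for u using AB[of u] p(2)[of "F u"] q(2)[of "F u"] by auto
    moreover have "(\<lambda>u. p (F u)) \<in> poly_fun" "(\<lambda>u. q (F u)) \<in> poly_fun"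
      by (rule poly_fun_comp[OF p(1) F], rule poly_fun_comp[OF q(1) F])
    ultimately show False using poly_fun_mult_eq_0[of "\<lambda>u. p (F u)" "\<lambda>u. q (F u)"] p(3) q(3) by auto
  qed
qed

text \<open>Density of the locus q \<noteq> 0: a polynomial that vanishes on \<open>U\<close>, once
  pulled back and multiplied by q, is identically zero. All orbit closures below are computed with
  this.\<close>

lemma range_subset_zclosure:
  assumes F: "\<And>i. (\<lambda>t. F t i) \<in> poly_fun" and q: "q \<in> poly_fun" "q s \<noteq> 0"
    and orb: "\<And>t. q t \<noteq> 0 \<Longrightarrow> F t \<in> U"
  shows "range F \<subseteq> zclosure U"
proof
  fix x assume "x \<in> range F"
  then obtain u where u: "x = F u" by auto
  show "x \<in> zclosure U"
    unfolding zclosure_def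
  proof (rule InterI, rule ccontr)
    fix S assume S: "S \<in> {S. zclosed S \<and> U \<subseteq> S}" and "x \<notin> S"
    then obtain p where p: "p \<in> poly_fun" "\<And>y. y \<in> S \<Longrightarrow> p y = 0" "p x \<noteq> 0"
      using zclosed_separate by blast
    have "p (F t) * q t = 0" for t using p(2) S orb[of t] by auto
    moreover have "(\<lambda>t. p (F t)) \<in> poly_fun" by (rule poly_fun_comp[OF p(1) F])
    ultimately show False using poly_fun_mult_eq_0[OF _ q(1), of "\<lambda>t. p (F t)"] q(2) p(3) u by auto
  qed
qed

text \<open>The points \<open>w i\<close> rule out every inclusion between different
  \<open>Z i\<close>, and an irreducible subset of a finite union of closed sets lies in one of
  them; so the \<open>Z i\<close> are exactly the maximal irreducible subsets.\<close>

lemma irr_components_UN: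
  fixes Z :: "'i::finite \<Rightarrow> ('a \<Rightarrow> complex) set"
  assumes irr: "\<And>i. zirred (Z i)" and w: "\<And>i j. w i \<in> Z j \<longleftrightarrow> i = j"
  shows "irr_components (\<Union>i. Z i) = range Z"
proof -
  have sub: "\<exists>i. W \<subseteq> Z i" if "zirred W" "W \<subseteq> (\<Union>i. Z i)" for W
    using zirred_subset_UN[OF that(1) finite _ that(2)] irr by (auto simp: zirred_def)
  have inc: "i = j" if "Z i \<subseteq> Z j" for i j using w that by blast
  show ?thesis
  proof
    show "irr_components (\<Union>i. Z i) \<subseteq> range Z"
    proof
      fix C assume C: "C \<in> irr_components (\<Union>i. Z i)"
      then have C: "zirred C" "C \<subseteq> (\<Union>i. Z i)"
        "\<And>W. zirred W \<Longrightarrow> W \<subseteq> (\<Union>i. Z i) \<Longrightarrow> C \<subseteq> W \<Longrightarrow> W = C"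
        unfolding irr_components_def by auto
      obtain i where i: "C \<subseteq> Z i" using sub[OF C(1,2)] by auto
      have "Z i = C" by (rule C(3)[OF irr _ i]) auto
      then show "C \<in> range Z" by auto
    qed
    show "range Z \<subseteq> irr_components (\<Union>i. Z i)"
    proof
      fix C assume "C \<in> range Z"
      then obtain i where C: "C = Z i" by auto
      have "W = Z i" if W: "zirred W" "W \<subseteq> (\<Union>i. Z i)" "Z i \<subseteq> W" for W
      proof -
        obtain j where j: "W \<subseteq> Z j" using sub[OF W(1,2)] by auto
        then have "i = j" using W(3) inc by (meson subset_trans)
        then show ?thesis using j W(3) by auto
      qed
      then show "C \<in> irr_components (\<Union>i. Z i)"
        unfolding irr_components_def C using irr[of i] by (auto simp del: UN_subset_iff)
    qed
  qed
qed

section \<open>Krull dimension\<close>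

text \<open>Polynomials in the entries of a list, of degree at most \<open>N\<close> in each; the coefficients are
  indexed by lists of exponents.\<close>
fun peval :: "nat \<Rightarrow> (nat list \<Rightarrow> complex) \<Rightarrow> complex list \<Rightarrow> complex" where
  "peval N c [] = c []"
| "peval N c (y # ys) = (\<Sum>k\<le>N. y ^ k * peval N (\<lambda>\<beta>. c (k # \<beta>)) ys)"

definition exps :: "nat \<Rightarrow> nat \<Rightarrow> nat list set" where
  "exps N n = {\<alpha>. set \<alpha> \<subseteq> {..N} \<and> length \<alpha> = n}"

fun monom_list :: "complex list \<Rightarrow> nat list \<Rightarrow> complex" where
  "monom_list (y # ys) (k # \<alpha>) = y ^ k * monom_list ys \<alpha>"
| "monom_list _ _ = 1"

text \<open>The conclusion is restricted to \<open>exps N (length fs)\<close> because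
  \<open>peval\<close> reads \<open>c\<close> only at these exponent lists.\<close>

definition alg_indep :: "('a \<Rightarrow> complex) set \<Rightarrow> (('a \<Rightarrow> complex) \<Rightarrow> complex) list \<Rightarrow> bool" where
  "alg_indep Z fs \<longleftrightarrow> (\<forall>N c. (\<forall>x\<in>Z. peval N c (map (\<lambda>f. f x) fs) = 0) \<longrightarrow>
     (\<forall>\<alpha>\<in>exps N (length fs). c \<alpha> = 0))"

lemma exps_0: "exps N 0 = {[]}"
  by (auto simp: exps_def)

lemma exps_Suc: "exps N (Suc n) = (\<lambda>(k, \<beta>). k # \<beta>) ` ({..N} \<times> exps N n)"
  by (force simp: exps_def length_Suc_conv image_iff)

lemma finite_exps: "finite (exps N n)" and card_exps: "card (exps N n) = Suc N ^ n"
  using finite_lists_length_eq[of "{..N}" n] card_lists_length_eq[of "{..N}" n]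
  by (auto simp: exps_def)

text \<open>The recursion peels off one variable, as adding a function to an independent list
  requires; the flat sum over monomials is the form for linear algebra.\<close>

lemma peval_eq_sum: "peval N c ys = (\<Sum>\<alpha>\<in>exps N (length ys). c \<alpha> * monom_list ys \<alpha>)"
proof (induction ys arbitrary: c)
  case Nil
  then show ?case by (simp add: exps_0)
next
  case (Cons y ys)
  have "(\<Sum>\<alpha>\<in>exps N (length (y # ys)). c \<alpha> * monom_list (y # ys) \<alpha>)
      = (\<Sum>(k, \<beta>)\<in>{..N} \<times> exps N (length ys). c (k # \<beta>) * (y ^ k * monom_list ys \<beta>))"
    unfolding length_Cons exps_Suc
    by (subst sum.reindex) (auto simp: inj_on_def intro!: sum.cong)
  also have "\<dots> = (\<Sum>k\<le>N. \<Sum>\<beta>\<in>exps N (length ys). c (k # \<beta>) * (y ^ k * monom_list ys \<beta>))"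
    by (simp add: sum.cartesian_product)
  also have "\<dots> = peval N c (y # ys)"
    by (simp add: Cons sum_distrib_left mult_ac)
  finally show ?case by simp
qed

text \<open>Inserting at each step of a chain a function that vanishes on the smaller set but not on the
  larger one turns a chain of length \<open>n\<close> into \<open>n\<close> algebraically independent functions.\<close>
lemma alg_indep_Cons:
  assumes ind: "alg_indep Z fs" and irr: "zirred Z'" and sub: "Z \<subseteq> Z'"
    and poly: "h \<in> poly_fun" "set fs \<subseteq> poly_fun"
    and h0: "\<And>x. x \<in> Z \<Longrightarrow> h x = 0" and y: "y \<in> Z'" "h y \<noteq> 0"
  shows "alg_indep Z' (h # fs)"
  unfolding alg_indep_def
proof (intro allI impI)
  fix N c
  assume zero: "\<forall>x\<in>Z'. peval N c (map (\<lambda>f. f x) (h # fs)) = 0"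
  define p where "p k x = peval N (\<lambda>\<beta>. c (k # \<beta>)) (map (\<lambda>f. f x) fs)" for k x
  have p_poly: "p k \<in> poly_fun" for k
  proof -
    have "(\<lambda>x. peval N d (map (\<lambda>f. f x) gs)) \<in> poly_fun" if "set gs \<subseteq> poly_fun" for d gs
      using that
    proof (induction gs arbitrary: d)
      case Nil
      then show ?case by (simp add: poly_fun.const)
    next
      case (Cons g gs)
      have "(\<lambda>x. \<Sum>k\<le>M. g x ^ k * peval N (\<lambda>\<beta>. d (k # \<beta>)) (map (\<lambda>f. f x) gs)) \<in> poly_fun" for M
        using Cons by (induction M) (auto intro!: poly_fun_intros)
      then show ?case by simp
    qed
    then show ?thesis unfolding p_def using poly(2) by blast
  qed
  have "\<forall>\<beta>\<in>exps N (length fs). c (k # \<beta>) = 0" if "k \<le> N" for k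
    using that
  proof (induction k rule: less_induct)
    case (less k)
    \<comment> \<open>Once the coefficients below \<open>k\<close> vanish, the relation is h^k times
      \<open>r\<close>. Since h is not identically zero on the irreducible \<open>Z'\<close>,
      \<open>r\<close> vanishes there, and on \<open>Z\<close>, where h is 0, only the coefficient
      \<open>p k\<close> is left of it.\<close>
    define r where "r x = (\<Sum>j\<le>N-k. h x ^ j * p (k + j) x)" for x
    have r_poly: "r \<in> poly_fun"
    proof -
      have "(\<lambda>x. \<Sum>j\<le>M. h x ^ j * p (k + j) x) \<in> poly_fun" for M
        by (induction M) (auto intro!: poly_fun_intros p_poly poly)
      then show ?thesis by (simp add: r_def[abs_def])
    qed
    have low: "p j x = 0" if "j < k" for j x
      using less that unfolding p_def peval_eq_sum by (intro sum.neutral) auto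
    have "h x ^ k * r x = 0" if "x \<in> Z'" for x
    proof -
      have "0 = (\<Sum>j\<le>N. h x ^ j * p j x)" using zero that by (simp add: p_def)
      also have "\<dots> = (\<Sum>j\<in>{k..N}. h x ^ j * p j x)"
        by (rule sum.mono_neutral_right) (auto simp: low)
      also have "\<dots> = (\<Sum>j\<le>N-k. h x ^ (k + j) * p (k + j) x)"
        by (rule sum.reindex_bij_witness[of _ "\<lambda>j. k + j" "\<lambda>j. j - k"]) (use less in auto)
      also have "\<dots> = h x ^ k * r x"
        by (simp add: r_def sum_distrib_left power_add mult_ac)
      finally show ?thesis by simp
    qed
    then have "Z' \<subseteq> {x. h x = 0} \<union> {x. r x = 0}" by auto
    moreover have "zclosed {x. h x = 0}" "zclosed {x. r x = 0}"
      by (intro zclosed_eq poly r_poly poly_fun.const)+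
    ultimately have "Z' \<subseteq> {x. h x = 0} \<or> Z' \<subseteq> {x. r x = 0}"
      using irr unfolding zirred_def by blast
    then have r0: "r x = 0" if "x \<in> Z'" for x using y that by auto
    have "p k x = 0" if "x \<in> Z" for x
    proof -
      have "r x = (\<Sum>j\<in>{0}. h x ^ j * p (k + j) x)"
        unfolding r_def by (rule sum.mono_neutral_right) (auto simp: h0[OF that])
      then show ?thesis using r0 that sub by auto
    qed
    then show ?case using ind unfolding alg_indep_def p_def by auto
  qed
  then show "\<forall>\<alpha>\<in>exps N (length (h # fs)). c \<alpha> = 0" by (auto simp: exps_Suc)
qed

lemma krull_ge_alg_indep:
  assumes "krull_ge X n"
  obtains fs where "length fs = n" and "set fs \<subseteq> poly_fun" and "alg_indep X fs"
proof -
  obtain Z :: "nat \<Rightarrow> _" where Z: "\<And>i. i \<le> n \<Longrightarrow> zirred (Z i) \<and> Z i \<subseteq> X"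
    and step: "\<And>i. i < n \<Longrightarrow> Z i \<subset> Z (Suc i)"
    using assms unfolding krull_ge_def by blast
  have "\<exists>fs. length fs = i \<and> set fs \<subseteq> poly_fun \<and> alg_indep (Z i) fs" if "i \<le> n" for i
    using that
  proof (induction i)
    case 0
    \<comment> \<open>Nonemptiness starts the induction: a constant that vanishes at some point is
      0, so the empty list is independent.\<close>
    have "Z 0 \<noteq> {}" using Z[of 0] by (auto simp: zirred_def)
    then show ?case by (intro exI[of _ "[]"]) (auto simp: alg_indep_def exps_0)
  next
    case (Suc i)
    then obtain fs where fs: "length fs = i" "set fs \<subseteq> poly_fun" "alg_indep (Z i) fs" by auto
    obtain y where y: "y \<in> Z (Suc i)" "y \<notin> Z i" using step[of i] Suc by auto
    have "zclosed (Z i)" using Z[of i] Suc by (auto simp: zirred_def)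
    then obtain h where h: "h \<in> poly_fun" "\<And>x. x \<in> Z i \<Longrightarrow> h x = 0" "h y \<noteq> 0"
      using zclosed_separate y(2) by blast
    have "alg_indep (Z (Suc i)) (h # fs)"
      by (rule alg_indep_Cons[OF fs(3) _ _ h(1) fs(2) h(2) y(1) h(3)])
        (use Z[of "Suc i"] step[of i] Suc in auto)
    then show ?case using fs h by (intro exI[of _ "h # fs"]) auto
  qed
  then obtain fs where fs: "length fs = n" "set fs \<subseteq> poly_fun" "alg_indep (Z n) fs" by blast
  have "alg_indep X fs" using fs(3) Z[of n] unfolding alg_indep_def by blast
  then show thesis using that fs by blast
qed

text \<open>Gaussian elimination: equation \<open>j\<close> is used to eliminate a pivot unknown
  \<open>i0\<close>, leaving one equation and one unknown fewer.\<close>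

lemma underdetermined_linear_system:
  fixes M :: "'i \<Rightarrow> 'j \<Rightarrow> 'k::field"
  assumes "finite J" and "finite I" and "card J < card I"
  shows "\<exists>c. (\<exists>i\<in>I. c i \<noteq> 0) \<and> (\<forall>j\<in>J. (\<Sum>i\<in>I. c i * M i j) = 0)"
  using assms
proof (induction J arbitrary: I M rule: finite_induct)
  case empty
  then have "I \<noteq> {}" by auto
  then show ?case by (intro exI[of _ "\<lambda>_. 1"]) auto
next
  case (insert j J)
  show ?case
  proof (cases "\<forall>i\<in>I. M i j = 0")
    case True
    then show ?thesis using insert.IH[OF insert.prems(1), of M] insert by auto
  next
    case False
    then obtain i0 where i0: "i0 \<in> I" "M i0 j \<noteq> 0" by auto
    define I' where "I' = I - {i0}"
    have I: "I = insert i0 I'" "i0 \<notin> I'" "finite I'" using i0 insert.prems by (auto simp: I'_def)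
    have "card J < card I'" using insert I by simp
    then obtain c where c: "\<exists>i\<in>I'. c i \<noteq> 0"
      "\<And>j'. j' \<in> J \<Longrightarrow> (\<Sum>i\<in>I'. c i * (M i j' - M i j / M i0 j * M i0 j')) = 0"
      using insert.IH[OF I(3), of "\<lambda>i j'. M i j' - M i j / M i0 j * M i0 j'"] by auto
    \<comment> \<open>The value \<open>- s\<close> at \<open>i0\<close> is the one that solves
      equation \<open>j\<close> itself.\<close>
    define s where "s = (\<Sum>i\<in>I'. c i * M i j) / M i0 j"
    define d where "d = c(i0 := - s)"
    have sum_d: "(\<Sum>i\<in>I. d i * m i) = (\<Sum>i\<in>I'. c i * m i) - s * m i0" for m :: "'i \<Rightarrow> 'k"
    proof -
      have "(\<Sum>i\<in>I'. d i * m i) = (\<Sum>i\<in>I'. c i * m i)"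
        by (rule sum.cong) (use I(2) in \<open>auto simp: d_def\<close>)
      then show ?thesis using I by (simp add: d_def)
    qed
    have "(\<Sum>i\<in>I. d i * M i j) = 0" unfolding sum_d using i0 by (simp add: s_def)
    moreover have "(\<Sum>i\<in>I. d i * M i j') = 0" if "j' \<in> J" for j'
      unfolding sum_d using c(2)[OF that]
      by (simp add: s_def algebra_simps sum_subtractf sum_distrib_left sum_divide_distrib)
    moreover have "\<exists>i\<in>I. d i \<noteq> 0" using c(1) I by (auto simp: d_def)
    ultimately show ?thesis by auto
  qed
qed

section \<open>Monomial counting: more polynomials than variables are algebraically
  dependent\<close>

definition mon :: "('b::finite \<Rightarrow> nat) \<Rightarrow> ('b \<Rightarrow> complex) \<Rightarrow> complex" where
  "mon \<beta> t = (\<Prod>i\<in>UNIV. t i ^ \<beta> i)"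

text \<open>The bound is on each exponent separately, not on the total degree, so the exponents form
  a product set of exactly (D+1)^n elements and bounds add under multiplication.\<close>

definition bounded_exps :: "nat \<Rightarrow> ('b::finite \<Rightarrow> nat) set" where
  "bounded_exps D = {\<beta>. \<forall>i. \<beta> i \<le> D}"

definition bounded_polys :: "nat \<Rightarrow> (('b::finite \<Rightarrow> complex) \<Rightarrow> complex) set" where
  "bounded_polys D = range (\<lambda>m t. \<Sum>\<beta>\<in>bounded_exps D. m \<beta> * mon \<beta> t)"

lemma bounded_exps_eq: "bounded_exps D = PiE UNIV (\<lambda>_. {..D})"
  by (auto simp: bounded_exps_def PiE_def Pi_def)

lemma finite_bounded_exps: "finite (bounded_exps D :: ('b::finite \<Rightarrow> nat) set)"
  unfolding bounded_exps_eq by (rule finite_PiE) auto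

lemma card_bounded_exps: "card (bounded_exps D :: ('b::finite \<Rightarrow> nat) set) = Suc D ^ CARD('b)"
  unfolding bounded_exps_eq by (subst card_PiE) auto

lemma bounded_polysI: "(\<And>t. f t = (\<Sum>\<beta>\<in>bounded_exps D. m \<beta> * mon \<beta> t)) \<Longrightarrow> f \<in> bounded_polys D"
  unfolding bounded_polys_def by auto

lemma bounded_polys_add:
  assumes "f \<in> bounded_polys D" and "g \<in> bounded_polys D"
  shows "(\<lambda>t. f t + g t) \<in> bounded_polys D"
proof -
  obtain m n where "f = (\<lambda>t. \<Sum>\<beta>\<in>bounded_exps D. m \<beta> * mon \<beta> t)"
    "g = (\<lambda>t. \<Sum>\<beta>\<in>bounded_exps D. n \<beta> * mon \<beta> t)"
    using assms unfolding bounded_polys_def by blast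
  then show ?thesis
    by (intro bounded_polysI[where m="\<lambda>\<beta>. m \<beta> + n \<beta>"]) (simp add: sum.distrib algebra_simps)
qed

lemma bounded_polys_mon:
  assumes "\<beta> \<in> bounded_exps D"
  shows "(\<lambda>t. c * mon \<beta> t) \<in> bounded_polys D"
proof (rule bounded_polysI[where m="\<lambda>\<gamma>. if \<gamma> = \<beta> then c else 0"])
  fix t
  have "(\<Sum>\<gamma>\<in>bounded_exps D. (if \<gamma> = \<beta> then c else 0) * mon \<gamma> t)
      = (\<Sum>\<gamma>\<in>bounded_exps D. if \<gamma> = \<beta> then c * mon \<gamma> t else 0)"
    by (rule sum.cong) auto
  then show "c * mon \<beta> t = (\<Sum>\<gamma>\<in>bounded_exps D. (if \<gamma> = \<beta> then c else 0) * mon \<gamma> t)"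
    using assms by (simp add: finite_bounded_exps sum.delta)
qed

lemma bounded_polys_sum:
  assumes "finite S" and "\<And>s. s \<in> S \<Longrightarrow> f s \<in> bounded_polys D"
  shows "(\<lambda>t. \<Sum>s\<in>S. f s t) \<in> bounded_polys D"
  using assms
proof (induction rule: finite_induct)
  case empty
  show ?case by (rule bounded_polysI[where m="\<lambda>_. 0"]) simp
next
  case (insert s S)
  then show ?case by (auto intro: bounded_polys_add)
qed

lemma bounded_polys_mult:
  assumes "f \<in> bounded_polys D" and "g \<in> bounded_polys E"
  shows "(\<lambda>t. f t * g t) \<in> bounded_polys (D + E)"
proof -
  obtain m n where f: "f = (\<lambda>t. \<Sum>\<beta>\<in>bounded_exps D. m \<beta> * mon \<beta> t)"
    and g: "g = (\<lambda>t. \<Sum>\<beta>\<in>bounded_exps E. n \<beta> * mon \<beta> t)"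
    using assms unfolding bounded_polys_def by blast
  have eq: "(\<lambda>t. f t * g t) = (\<lambda>t. \<Sum>\<beta>\<in>bounded_exps D. \<Sum>\<gamma>\<in>bounded_exps E.
      (m \<beta> * n \<gamma>) * mon (\<lambda>i. \<beta> i + \<gamma> i) t)"
    by (simp add: f g sum_product mon_def power_add prod.distrib mult_ac)
  show ?thesis unfolding eq
    by (intro bounded_polys_sum finite_bounded_exps bounded_polys_mon)
      (auto simp: bounded_exps_def add_mono)
qed

lemma bounded_polys_mono:
  assumes "D \<le> E" and "f \<in> bounded_polys D"
  shows "f \<in> bounded_polys E"
proof -
  obtain m where f: "f = (\<lambda>t. \<Sum>\<beta>\<in>bounded_exps D. m \<beta> * mon \<beta> t)"
    using assms(2) unfolding bounded_polys_def by blast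
  show ?thesis unfolding f using assms(1)
    by (intro bounded_polys_sum finite_bounded_exps bounded_polys_mon)
      (auto simp: bounded_exps_def intro: le_trans)
qed

lemma bounded_polys_const: "(\<lambda>_. c) \<in> bounded_polys D"
  using bounded_polys_mon[of "\<lambda>_. 0" D c] by (simp add: bounded_exps_def mon_def)

lemma poly_fun_bounded:
  assumes "f \<in> poly_fun"
  shows "\<exists>D. f \<in> bounded_polys D"
  using assms
proof induction
  case (coord i)
  have "mon (\<lambda>j. if j = i then 1 else 0) t = t i" for t :: "'a \<Rightarrow> complex"
  proof -
    have "mon (\<lambda>j. if j = i then 1 else 0) t = (\<Prod>j\<in>UNIV. if j = i then t j else 1)"
      unfolding mon_def by (rule prod.cong) auto
    then show ?thesis by simp
  qed
  moreover have "(\<lambda>j. if j = i then 1 else 0) \<in> bounded_exps 1" by (simp add: bounded_exps_def)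
  ultimately show ?case using bounded_polys_mon[of "\<lambda>j. if j = i then 1 else 0" 1 1] by auto
next
  case (const c)
  then show ?case using bounded_polys_const by blast
next
  case (add p q)
  then obtain D E where "p \<in> bounded_polys D" "q \<in> bounded_polys E" by auto
  then have "p \<in> bounded_polys (max D E)" "q \<in> bounded_polys (max D E)"
    by (auto intro: bounded_polys_mono[of D] bounded_polys_mono[of E])
  then show ?case using bounded_polys_add by blast
next
  case (mult p q)
  then show ?case using bounded_polys_mult by blast
qed

text \<open>A box of \<open>(N+1)^(n+1)\<close> monomials in \<open>n+1\<close> polynomials of degree at most \<open>D\<close> lies in a space
  of dimension \<open>((n+1)ND+1)^n\<close>, which is smaller for large \<open>N\<close>.\<close>
lemma poly_funs_alg_dependent:
  fixes gs :: "(('b::finite \<Rightarrow> complex) \<Rightarrow> complex) list"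
  assumes "set gs \<subseteq> poly_fun" and len: "length gs = Suc (CARD('b))"
  shows "\<exists>N c. (\<exists>\<alpha>\<in>exps N (length gs). c \<alpha> \<noteq> 0) \<and> (\<forall>t. peval N c (map (\<lambda>g. g t) gs) = 0)"
proof -
  let ?n = "CARD('b)"
  have "\<exists>D. \<forall>g\<in>set gs. g \<in> bounded_polys D"
    using assms(1)
  proof (induction gs)
    case (Cons g gs)
    then obtain E where "\<forall>g\<in>set gs. g \<in> bounded_polys E" by auto
    moreover obtain D where "g \<in> bounded_polys D" using poly_fun_bounded[of g] Cons.prems by auto
    ultimately show ?case
      by (intro exI[of _ "max D E"]) (auto intro: bounded_polys_mono[of D] bounded_polys_mono[of E])
  qed simp
  then obtain D where D: "\<And>g. g \<in> set gs \<Longrightarrow> g \<in> bounded_polys D" by blast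
  define C where "C = length gs * D"
  \<comment> \<open>With n variables, this value makes ((C+1)(N+1))^n equal to N (N+1)^n, just below
    the number (N+1)^(n+1) of unknowns.\<close>
  define N where "N = Suc C ^ ?n"
  have mon: "(\<lambda>t. monom_list (map (\<lambda>g. g t) hs) \<alpha>) \<in> bounded_polys (length hs * (N * D))"
    if "set hs \<subseteq> set gs" "\<alpha> \<in> exps N (length hs)" for hs \<alpha>
    using that
  proof (induction hs arbitrary: \<alpha>)
    case Nil
    then show ?case by (simp add: bounded_polys_const)
  next
    case (Cons h hs)
    then obtain k \<beta> where \<alpha>: "\<alpha> = k # \<beta>" "k \<le> N" "\<beta> \<in> exps N (length hs)" by (auto simp: exps_Suc)
    have "(\<lambda>t. h t ^ k) \<in> bounded_polys (k * D)"
    proof (induction k)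
      case 0
      then show ?case by (simp add: bounded_polys_const)
    next
      case (Suc k)
      then show ?case using bounded_polys_mult[OF D[of h] Suc] Cons.prems by simp
    qed
    then have "(\<lambda>t. h t ^ k) \<in> bounded_polys (N * D)"
      using bounded_polys_mono \<alpha>(2) by (metis mult_le_mono1)
    then show ?case using bounded_polys_mult[OF _ Cons.IH[OF _ \<alpha>(3)]] Cons.prems \<alpha>(1) by simp
  qed
  let ?B = "bounded_exps (C * N) :: ('b \<Rightarrow> nat) set"
  have "\<forall>\<alpha>\<in>exps N (length gs). \<exists>m. \<forall>t.
      monom_list (map (\<lambda>g. g t) gs) \<alpha> = (\<Sum>\<beta>\<in>?B. m \<beta> * mon \<beta> t)"
  proof
    fix \<alpha> assume "\<alpha> \<in> exps N (length gs)"
    then have "(\<lambda>t. monom_list (map (\<lambda>g. g t) gs) \<alpha>) \<in> bounded_polys (C * N)"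
      using mon[OF subset_refl] by (simp add: C_def mult_ac)
    then obtain m where "(\<lambda>t. monom_list (map (\<lambda>g. g t) gs) \<alpha>) = (\<lambda>t. \<Sum>\<beta>\<in>?B. m \<beta> * mon \<beta> t)"
      unfolding bounded_polys_def by blast
    then show "\<exists>m. \<forall>t. monom_list (map (\<lambda>g. g t) gs) \<alpha> = (\<Sum>\<beta>\<in>?B. m \<beta> * mon \<beta> t)"
      unfolding fun_eq_iff by (rule exI[of _ m])
  qed
  from bchoice[OF this] obtain M where M: "\<forall>\<alpha>\<in>exps N (length gs). \<forall>t.
      monom_list (map (\<lambda>g. g t) gs) \<alpha> = (\<Sum>\<beta>\<in>?B. M \<alpha> \<beta> * mon \<beta> t)"
    by (rule exE)
  have "Suc (C * N) \<le> Suc C * Suc N" by simp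
  then have "card ?B \<le> (Suc C * Suc N) ^ ?n" unfolding card_bounded_exps by (rule power_mono) simp
  also have "\<dots> = N * Suc N ^ ?n" by (simp only: power_mult_distrib N_def)
  also have "\<dots> < Suc N * Suc N ^ ?n" by simp
  also have "\<dots> = card (exps N (length gs))" by (simp add: card_exps len)
  finally obtain c where c: "\<exists>\<alpha>\<in>exps N (length gs). c \<alpha> \<noteq> 0"
    "\<And>\<beta>. \<beta> \<in> ?B \<Longrightarrow> (\<Sum>\<alpha>\<in>exps N (length gs). c \<alpha> * M \<alpha> \<beta>) = 0"
    using underdetermined_linear_system[OF finite_bounded_exps finite_exps, of "C * N" N "length gs" M]
    by auto
  have "peval N c (map (\<lambda>g. g t) gs) = 0" for t
  proof -
    have "peval N c (map (\<lambda>g. g t) gs)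
        = (\<Sum>\<alpha>\<in>exps N (length gs). c \<alpha> * (\<Sum>\<beta>\<in>?B. M \<alpha> \<beta> * mon \<beta> t))"
      by (simp add: peval_eq_sum M)
    also have "\<dots> = (\<Sum>\<beta>\<in>?B. (\<Sum>\<alpha>\<in>exps N (length gs). c \<alpha> * M \<alpha> \<beta>) * mon \<beta> t)"
      by (simp add: sum_distrib_left sum_distrib_right mult_ac)
        (rule sum.swap)
    also have "\<dots> = 0" by (simp add: c(2))
    finally show ?thesis .
  qed
  then show ?thesis using c(1) by blast
qed

text \<open>A relation between the pulled-back functions is a relation on the whole image, so
  independent functions on the image stay independent after composition with
  \<open>F\<close>.\<close>

lemma not_krull_ge_range:
  fixes F :: "('b::finite \<Rightarrow> complex) \<Rightarrow> 'a \<Rightarrow> complex"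
  assumes F: "\<And>i. (\<lambda>t. F t i) \<in> poly_fun"
  shows "\<not> krull_ge (range F) (Suc (CARD('b)))"
proof
  assume "krull_ge (range F) (Suc (CARD('b)))"
  then obtain fs where fs: "length fs = Suc (CARD('b))" "set fs \<subseteq> poly_fun" "alg_indep (range F) fs"
    by (rule krull_ge_alg_indep)
  define gs where "gs = map (\<lambda>f t. f (F t)) fs"
  have "set gs \<subseteq> poly_fun" using fs(2) by (auto simp: gs_def intro!: poly_fun_comp[where F=F] F)
  then obtain N c where c: "\<exists>\<alpha>\<in>exps N (length gs). c \<alpha> \<noteq> 0" "\<And>t. peval N c (map (\<lambda>g. g t) gs) = 0"
    using poly_funs_alg_dependent[of gs] fs(1) by (auto simp: gs_def)
  have "\<forall>x\<in>range F. peval N c (map (\<lambda>f. f x) fs) = 0" using c(2) by (auto simp: gs_def o_def)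
  then have "\<forall>\<alpha>\<in>exps N (length fs). c \<alpha> = 0" using fs(3) unfolding alg_indep_def by blast
  then show False using c(1) by (simp add: gs_def)
qed

lemma krull_ge_mono:
  assumes "krull_ge X n" and "m \<le> n"
  shows "krull_ge X m"
proof -
  obtain Z :: "nat \<Rightarrow> _" where "\<forall>i\<le>n. zirred (Z i) \<and> Z i \<subseteq> X" "\<forall>i<n. Z i \<subset> Z (Suc i)"
    using assms(1) unfolding krull_ge_def by blast
  then have "(\<forall>i\<le>m. zirred (Z i) \<and> Z i \<subseteq> X) \<and> (\<forall>i<m. Z i \<subset> Z (Suc i))"
    using assms(2) by simp
  then show ?thesis unfolding krull_ge_def by (rule exI[of _ Z])
qed

section \<open>Structure constants and the eight components\<close>

lemma all_idx: "(\<forall>i. P i) \<longleftrightarrow> P E1 \<and> P F1 \<and> P F2"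
  by (metis idx.exhaust)

lemma deg_eq_1: "deg i = Suc 0 \<longleftrightarrow> i = F1 \<or> i = F2"
  by (cases i) auto

lemma sum_idx: "(\<Sum>i\<in>UNIV. f i) = f E1 + f F1 + f F2"
  by (simp add: UNIV_idx add.assoc)

lemma even_structD: "even_struct mu \<Longrightarrow> deg k \<noteq> (deg i + deg j) mod 2 \<Longrightarrow> mu (i, j, k) = 0"
  by (auto simp: even_struct_def)

lemma smult_left: "Defs.smult mu (Defs.smult mu x y) z k =
    (\<Sum>i\<in>UNIV. \<Sum>j\<in>UNIV. \<Sum>l\<in>UNIV. x i * y j * z l * (\<Sum>m\<in>UNIV. mu (i, j, m) * mu (m, l, k)))"
  unfolding Defs.smult_def sum_idx by (simp add: algebra_simps)

lemma smult_right: "Defs.smult mu x (Defs.smult mu y z) k =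
    (\<Sum>i\<in>UNIV. \<Sum>j\<in>UNIV. \<Sum>l\<in>UNIV. x i * y j * z l * (\<Sum>m\<in>UNIV. mu (j, l, m) * mu (i, m, k)))"
  unfolding Defs.smult_def sum_idx by (simp add: algebra_simps)

text \<open>Both identities are trilinear, so basis vectors suffice. The sign causes no trouble: a
  basis vector that occurs in a homogeneous y or z has the degree of that y or z.\<close>

lemma perm_struct_iff:
  "perm_struct mu \<longleftrightarrow> even_struct mu \<and> (\<forall>i j l k.
     (\<Sum>m\<in>UNIV. mu (i, j, m) * mu (m, l, k)) = (\<Sum>m\<in>UNIV. mu (j, l, m) * mu (i, m, k)) \<and>
     (\<Sum>m\<in>UNIV. mu (j, l, m) * mu (i, m, k)) =
       (-1) ^ (deg j * deg l) * (\<Sum>m\<in>UNIV. mu (l, j, m) * mu (i, m, k)))"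
  (is "_ \<longleftrightarrow> _ \<and> ?eqs")
proof
  assume perm: "perm_struct mu"
  define b where "b i = (\<lambda>j. if j = i then 1 else 0 :: complex)" for i :: idx
  have homog: "homog (b i) (deg i)" for i by (cases i) (auto simp: b_def homog_def)
  have b: "Defs.smult mu (b i) (b j) = (\<lambda>k. mu (i, j, k))" for i j
    by (cases i; cases j) (simp_all add: Defs.smult_def sum_idx b_def)
  have left: "Defs.smult mu (Defs.smult mu (b i) (b j)) (b l) k = (\<Sum>m\<in>UNIV. mu (i, j, m) * mu (m, l, k))"
    for i j l k unfolding b by (cases l) (simp_all add: Defs.smult_def sum_idx b_def)
  have right: "Defs.smult mu (b i) (Defs.smult mu (b j) (b l)) k = (\<Sum>m\<in>UNIV. mu (j, l, m) * mu (i, m, k))"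
    for i j l k unfolding b by (cases i) (simp_all add: Defs.smult_def sum_idx b_def)
  have key: "Defs.smult mu (Defs.smult mu (b i) (b j)) (b l) = Defs.smult mu (b i) (Defs.smult mu (b j) (b l)) \<and>
      Defs.smult mu (b i) (Defs.smult mu (b j) (b l)) =
        (\<lambda>k. (-1) ^ (deg j * deg l) * Defs.smult mu (b i) (Defs.smult mu (b l) (b j)) k)" for i j l
    using perm homog[of i] homog[of j] homog[of l] unfolding perm_struct_def by blast
  have ?eqs
  proof (intro allI conjI)
    fix i j l k
    show "(\<Sum>m\<in>UNIV. mu (i, j, m) * mu (m, l, k)) = (\<Sum>m\<in>UNIV. mu (j, l, m) * mu (i, m, k))"
      using fun_cong[OF conjunct1[OF key[of i j l]], of k] unfolding left right .
    show "(\<Sum>m\<in>UNIV. mu (j, l, m) * mu (i, m, k)) =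
        (-1) ^ (deg j * deg l) * (\<Sum>m\<in>UNIV. mu (l, j, m) * mu (i, m, k))"
      using fun_cong[OF conjunct2[OF key[of i j l]], of k] unfolding right .
  qed
  then show "even_struct mu \<and> ?eqs" using perm unfolding perm_struct_def by blast
next
  assume eqs: "even_struct mu \<and> ?eqs"
  have sign: "x i * y j * z l * (\<Sum>m\<in>UNIV. mu (j, l, m) * mu (i, m, k)) =
      (-1) ^ (dy * dz) * (x i * z l * y j * (\<Sum>m\<in>UNIV. mu (l, j, m) * mu (i, m, k)))"
    if "homog y dy" "homog z dz" for x y z dy dz i j l k
  proof (cases "y j = 0 \<or> z l = 0")
    case False
    then have "deg j = dy" "deg l = dz" using that by (auto simp: homog_def)
    moreover have "(\<Sum>m\<in>UNIV. mu (j, l, m) * mu (i, m, k)) =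
        (-1) ^ (deg j * deg l) * (\<Sum>m\<in>UNIV. mu (l, j, m) * mu (i, m, k))" using eqs by blast
    ultimately show ?thesis by simp
  qed auto
  have "Defs.smult mu x (Defs.smult mu y z) k = (-1) ^ (dy * dz) * Defs.smult mu x (Defs.smult mu z y) k"
    if "homog y dy" "homog z dz" for x y z dy dz k
  proof -
    define A where "A i j l = (\<Sum>m\<in>UNIV. mu (j, l, m) * mu (i, m, k))" for i j l
    have "Defs.smult mu x (Defs.smult mu y z) k
        = (\<Sum>i\<in>UNIV. \<Sum>j\<in>UNIV. \<Sum>l\<in>UNIV. (-1) ^ (dy * dz) * (x i * z l * y j * A i l j))"
      unfolding smult_right A_def by (intro sum.cong refl sign[OF that])
    also have "\<dots> = (\<Sum>i\<in>UNIV. \<Sum>l\<in>UNIV. \<Sum>j\<in>UNIV. (-1) ^ (dy * dz) * (x i * z l * y j * A i l j))"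
      by (rule sum.cong[OF refl], rule sum.swap)
    also have "\<dots> = (-1) ^ (dy * dz) * Defs.smult mu x (Defs.smult mu z y) k"
      unfolding smult_right A_def[symmetric] sum_distrib_left ..
    finally show ?thesis .
  qed
  moreover have "Defs.smult mu (Defs.smult mu x y) z = Defs.smult mu x (Defs.smult mu y z)" for x y z
  proof
    fix k
    have "(\<Sum>m\<in>UNIV. mu (i, j, m) * mu (m, l, k)) = (\<Sum>m\<in>UNIV. mu (j, l, m) * mu (i, m, k))"
      for i j l using eqs by blast
    then show "Defs.smult mu (Defs.smult mu x y) z k = Defs.smult mu x (Defs.smult mu y z) k"
      unfolding smult_left smult_right by simp
  qed
  ultimately show "perm_struct mu" unfolding perm_struct_def fun_eq_iff using eqs by blast
qed

text \<open>\<open>L\<close> and \<open>R\<close> act on columns, so the index order of the structure constants is transposed.\<close>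
definition mk :: "complex \<Rightarrow> mat \<Rightarrow> mat \<Rightarrow> mat \<Rightarrow> sstruct" where
  "mk a L R B = (\<lambda>(i, j, k).
     if deg k \<noteq> (deg i + deg j) mod 2 then 0
     else if k = E1 then (if i = E1 then a else B i j)
     else if i = E1 then L k j else R k i)"

lemma mk_simps [simp]:
  "mk a L R B (E1, E1, E1) = a"
  "deg j = 1 \<Longrightarrow> deg k = 1 \<Longrightarrow> mk a L R B (E1, j, k) = L k j"
  "deg j = 1 \<Longrightarrow> deg k = 1 \<Longrightarrow> mk a L R B (j, E1, k) = R k j"
  "deg i = 1 \<Longrightarrow> deg j = 1 \<Longrightarrow> mk a L R B (i, j, E1) = B i j"
  by (cases i; cases j; cases k; simp add: mk_def)+

lemma mk_odd [simp]: "deg k \<noteq> (deg i + deg j) mod 2 \<Longrightarrow> mk a L R B (i, j, k) = 0"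
  by (simp add: mk_def)

lemma even_struct_mk: "even_struct (mk a L R B)"
  unfolding even_struct_def using mk_odd by metis

lemma eq_mkI:
  assumes "even_struct mu" and "mu (E1, E1, E1) = a"
    and "\<And>j k. deg j = 1 \<Longrightarrow> deg k = 1 \<Longrightarrow> mu (E1, j, k) = L k j \<and> mu (j, E1, k) = R k j \<and> mu (j, k, E1) = B j k"
  shows "mu = mk a L R B"
proof
  fix t :: "idx \<times> idx \<times> idx"
  obtain i j k where t: "t = (i, j, k)" by (cases t)
  show "mu t = mk a L R B t"
    unfolding t using assms(2,3) even_structD[OF assms(1), of k i j]
    by (cases i; cases j; cases k; simp)
qed

section \<open>Equations and parametrizations of the eight closed sets\<close>

datatype par = V1 | V2 | W1 | W2

lemma UNIV_par: "(UNIV :: par set) = {V1, V2, W1, W2}"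
  using par.exhaust by auto

instance par :: finite
  by standard (simp add: UNIV_par)

lemma card_par: "CARD(par) = 4"
  by (simp add: UNIV_par)

datatype comp = C04 | C06 | C09 | C15 | C17 | C19 | C22 | C24

lemma UNIV_comp: "(UNIV :: comp set) = {C04, C06, C09, C15, C17, C19, C22, C24}"
  using comp.exhaust by auto

instance comp :: finite
  by standard (simp add: UNIV_comp)

lemma card_comp: "CARD(comp) = 8"
  by (simp add: UNIV_comp)

fun mat2 :: "complex \<Rightarrow> complex \<Rightarrow> complex \<Rightarrow> complex \<Rightarrow> mat" where
  "mat2 p q r s F1 F1 = p"
| "mat2 p q r s F1 F2 = q"
| "mat2 p q r s F2 F1 = r"
| "mat2 p q r s F2 F2 = s"
| "mat2 p q r s _ _ = 0"

text \<open>The product v w^T of a column and a row. Since w v = \<open>tr t\<close>, it satisfies X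
  X = a X exactly in the normalization a = \<open>tr t\<close>.\<close>

definition outer :: "(par \<Rightarrow> complex) \<Rightarrow> mat" where
  "outer t = mat2 (t V1 * t W1) (t V1 * t W2) (t V2 * t W1) (t V2 * t W2)"

definition tr :: "(par \<Rightarrow> complex) \<Rightarrow> complex" where
  "tr t = t V1 * t W1 + t V2 * t W2"

abbreviation scalar :: "complex \<Rightarrow> mat" where
  "scalar c \<equiv> mat2 c 0 0 c"

text \<open>This is s times the column (p, -q) times the row (q, p). The row kills the column, so
  the square is 0.\<close>

definition nil :: "complex \<Rightarrow> complex \<Rightarrow> complex \<Rightarrow> mat" where
  "nil s p q = mat2 (s * (p * q)) (s * (p * p)) (- s * (q * q)) (- s * (p * q))"

text \<open>Where only a single number is free, it is still written as \<open>tr t\<close>, so that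
  one formula for t in terms of the group element serves all six sets with generic a \<noteq>
  0.\<close>

fun param :: "comp \<Rightarrow> (par \<Rightarrow> complex) \<Rightarrow> sstruct" where
  "param C04 t = mk 0 (scalar 0) (scalar 0) (mat2 (t V1) (t V2) (t W1) (t W2))"
| "param C06 t = mk 0 (nil (t W1) (t V1) (t V2)) (nil (t W2) (t V1) (t V2)) (scalar 0)"
| "param C09 t = mk (tr t) (scalar 0) (outer t) (scalar 0)"
| "param C15 t = mk (tr t) (outer t) (scalar (tr t)) (scalar 0)"
| "param C17 t = mk (tr t) (outer t) (outer t) (scalar 0)"
| "param C19 t = mk (tr t) (scalar 0) (scalar 0) (scalar 0)"
| "param C22 t = mk (tr t) (scalar 0) (scalar (tr t)) (scalar 0)"
| "param C24 t = mk (tr t) (scalar (tr t)) (scalar (tr t)) (scalar 0)"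

definition odd_prods_zero :: "sstruct \<Rightarrow> bool" where
  "odd_prods_zero mu \<longleftrightarrow>
    mu (F1, F1, E1) = 0 \<and> mu (F1, F2, E1) = 0 \<and> mu (F2, F1, E1) = 0 \<and> mu (F2, F2, E1) = 0"

definition left_scalar :: "complex \<Rightarrow> sstruct \<Rightarrow> bool" where
  "left_scalar c mu \<longleftrightarrow>
    mu (E1, F1, F1) = c \<and> mu (E1, F1, F2) = 0 \<and> mu (E1, F2, F1) = 0 \<and> mu (E1, F2, F2) = c"

definition right_scalar :: "complex \<Rightarrow> sstruct \<Rightarrow> bool" where
  "right_scalar c mu \<longleftrightarrow>
    mu (F1, E1, F1) = c \<and> mu (F1, E1, F2) = 0 \<and> mu (F2, E1, F1) = 0 \<and> mu (F2, E1, F2) = c"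

text \<open>Determinant 0 and trace a imply L L = a L by Cayley-Hamilton. Unlike "a times a rank-one
  idempotent" this is a closed condition; at a = 0 it also admits nilpotent L.\<close>

definition left_rank1 :: "sstruct \<Rightarrow> bool" where
  "left_rank1 mu \<longleftrightarrow> mu (E1, F1, F1) * mu (E1, F2, F2) = mu (E1, F1, F2) * mu (E1, F2, F1) \<and>
    mu (E1, F1, F1) + mu (E1, F2, F2) = mu (E1, E1, E1)"

definition right_rank1 :: "sstruct \<Rightarrow> bool" where
  "right_rank1 mu \<longleftrightarrow> mu (F1, E1, F1) * mu (F2, E1, F2) = mu (F1, E1, F2) * mu (F2, E1, F1) \<and>
    mu (F1, E1, F1) + mu (F2, E1, F2) = mu (E1, E1, E1)"

definition comp0 :: "(idx \<Rightarrow> idx \<Rightarrow> complex) \<Rightarrow> (idx \<Rightarrow> idx \<Rightarrow> complex) \<Rightarrow> bool" where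
  "comp0 X Y \<longleftrightarrow> (\<forall>j k. (\<Sum>m\<in>UNIV. X j m * Y m k) = 0)"

fun comp_eqs :: "comp \<Rightarrow> sstruct \<Rightarrow> bool" where
  "comp_eqs C04 mu \<longleftrightarrow> mu (E1, E1, E1) = 0 \<and> left_scalar 0 mu \<and> right_scalar 0 mu"
| "comp_eqs C06 mu \<longleftrightarrow> mu (E1, E1, E1) = 0 \<and> odd_prods_zero mu \<and>
     comp0 (\<lambda>j m. mu (E1, j, m)) (\<lambda>j m. mu (E1, j, m)) \<and>
     comp0 (\<lambda>j m. mu (j, E1, m)) (\<lambda>j m. mu (j, E1, m)) \<and>
     comp0 (\<lambda>j m. mu (E1, j, m)) (\<lambda>j m. mu (j, E1, m)) \<and>
     comp0 (\<lambda>j m. mu (j, E1, m)) (\<lambda>j m. mu (E1, j, m))"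
| "comp_eqs C09 mu \<longleftrightarrow> odd_prods_zero mu \<and> left_scalar 0 mu \<and> right_rank1 mu"
| "comp_eqs C15 mu \<longleftrightarrow> odd_prods_zero mu \<and> left_rank1 mu \<and> right_scalar (mu (E1, E1, E1)) mu"
| "comp_eqs C17 mu \<longleftrightarrow> odd_prods_zero mu \<and> left_rank1 mu \<and>
     (\<forall>j k. mu (E1, j, k) = mu (j, E1, k))"
| "comp_eqs C19 mu \<longleftrightarrow> odd_prods_zero mu \<and> left_scalar 0 mu \<and> right_scalar 0 mu"
| "comp_eqs C22 mu \<longleftrightarrow> odd_prods_zero mu \<and> left_scalar 0 mu \<and> right_scalar (mu (E1, E1, E1)) mu"
| "comp_eqs C24 mu \<longleftrightarrow> odd_prods_zero mu \<and> left_scalar (mu (E1, E1, E1)) mu \<and>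
     right_scalar (mu (E1, E1, E1)) mu"

text \<open>This is the description by equations, from which closedness is read off;
  \<open>range_param\<close> identifies it with the image of \<open>param c\<close>.\<close>

definition comp_set :: "comp \<Rightarrow> sstruct set" where
  "comp_set c = {mu. even_struct mu \<and> comp_eqs c mu}"

lemmas comp_defs = odd_prods_zero_def left_scalar_def right_scalar_def left_rank1_def right_rank1_def
  comp0_def

lemma poly_fun_param: "(\<lambda>t. param c t x) \<in> poly_fun"
proof -
  obtain i j k where "x = (i, j, k)" by (cases x)
  then show ?thesis
    by (cases c; cases i; cases j; cases k;
        simp add: outer_def tr_def nil_def; intro poly_fun_intros)
qed

lemma zclosed_comp_set: "zclosed (comp_set c)"
proof -
  have "zclosed {mu :: sstruct. deg k \<noteq> (deg i + deg j) mod 2 \<longrightarrow> mu (i, j, k) = 0}" for i j k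
    by (intro zclosed_imp zclosed_eq poly_fun_intros)
  then have "zclosed {mu. even_struct mu}"
    unfolding even_struct_def by (intro zclosed_all) (simp add: imp_conv_disj disj_commute)
  moreover have "zclosed {mu. comp_eqs c mu}"
    by (cases c; simp only: comp_eqs.simps comp_defs sum_idx;
        intro zclosed_conj zclosed_all zclosed_eq poly_fun_intros)
  ultimately show ?thesis unfolding comp_set_def by (rule zclosed_conj)
qed

lemma param_in_comp_set: "param c t \<in> comp_set c"
  unfolding comp_set_def
  by (cases c; simp add: comp_defs even_struct_mk outer_def nil_def tr_def all_idx sum_idx algebra_simps)

lemma rank1_decomposition:
  fixes x y z w :: complex
  assumes "x * w = y * z"
  obtains v1 v2 w1 w2 where "x = v1 * w1" "y = v1 * w2" "z = v2 * w1" "w = v2 * w2"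
proof (cases "x = 0")
  case True
  then have "y = 0 \<or> z = 0" using assms by auto
  then show ?thesis
  proof
    assume "y = 0"
    \<comment> \<open>Positional arguments of \<open>that\<close> follow first occurrence:
      \<open>v1\<close>, \<open>w1\<close>, \<open>w2\<close>, \<open>v2\<close>.\<close>
    then show ?thesis using that[of 0 z w 1] True by simp
  next
    assume "z = 0"
    then show ?thesis using that[of y 0 1 w] True by simp
  qed
next
  case False
  then show ?thesis using that[of x 1 "y / x" z] assms by (simp add: field_simps)
qed

lemma nilpotent_decomposition:
  fixes x y z w :: complex
  assumes "x * x + y * z = 0" "x * y + y * w = 0" "z * x + w * z = 0" "z * y + w * w = 0"
  obtains p q where "x = p * q" "y = p * p" "z = - (q * q)" "w = - (p * q)"
proof -
  have "y * (x + w) = 0" "z * (x + w) = 0" using assms(2,3) by (auto simp: algebra_simps)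
  moreover have "(x - w) * (x + w) = (x * x + y * z) - (z * y + w * w)" by (simp add: algebra_simps)
  then have "(x - w) * (x + w) = 0" using assms(1,4) by simp
  ultimately have "x + w = 0" using assms(1,4) by auto
  then have w: "w = - x" by (simp add: eq_neg_iff_add_eq_0 add.commute)
  \<comment> \<open>Square roots are determined only up to sign, so p q is x or -x; replacing q by
    -q repairs the second case.\<close>
  define p q where "p = csqrt y" and "q = csqrt (- z)"
  have pq: "p * p = y" "q * q = - z" unfolding p_def q_def by (metis power2_csqrt power2_eq_square)+
  have "(p * q) * (p * q) = (p * p) * (q * q)" by (simp add: algebra_simps)
  also have "\<dots> = x * x" using assms(1) by (simp add: pq add_eq_0_iff)
  finally have "(p * q) * (p * q) = x * x" .
  then have "x = p * q \<or> x = p * (- q)" by (metis mult_minus_right square_eq_iff)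
  then show thesis using that[of p q] that[of p "- q"] pq w by auto
qed

text \<open>Each square-zero matrix is a column (p, -q) times a row (q, p). That the product of two
  of them vanishes means that the row of one kills the column of the other, which makes their pairs
  (p, q) proportional.\<close>

lemma nil_multiple:
  fixes l1 l2 l3 l4 r1 r2 r3 r4 :: complex
  assumes LL: "l1 * l1 + l2 * l3 = 0" "l1 * l2 + l2 * l4 = 0" "l3 * l1 + l4 * l3 = 0" "l3 * l2 + l4 * l4 = 0"
    and RR: "r1 * r1 + r2 * r3 = 0" "r1 * r2 + r2 * r4 = 0" "r3 * r1 + r4 * r3 = 0" "r3 * r2 + r4 * r4 = 0"
    and LR: "l1 * r1 + l2 * r3 = 0" "l1 * r2 + l2 * r4 = 0" "l3 * r1 + l4 * r3 = 0" "l3 * r2 + l4 * r4 = 0"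
    and RL: "r1 * l1 + r2 * l3 = 0" "r1 * l2 + r2 * l4 = 0" "r3 * l1 + r4 * l3 = 0" "r3 * l2 + r4 * l4 = 0"
  obtains s t p q where
    "l1 = s * (p * q)" "l2 = s * (p * p)" "l3 = - s * (q * q)" "l4 = - s * (p * q)"
    "r1 = t * (p * q)" "r2 = t * (p * p)" "r3 = - t * (q * q)" "r4 = - t * (p * q)"
proof -
  obtain p q where L: "l1 = p * q" "l2 = p * p" "l3 = - (q * q)" "l4 = - (p * q)"
    using nilpotent_decomposition[OF LL] by blast
  obtain a b where R: "r1 = a * b" "r2 = a * a" "r3 = - (b * b)" "r4 = - (a * b)"
    using nilpotent_decomposition[OF RR] by blast
  show thesis
  proof (cases "p = 0 \<and> q = 0")
    case True
    then show thesis using that[of 0 a b 1] L R by simp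
  next
    case pq: False
    \<comment> \<open>Both entries of L R used here contain the factor q a - p b, the pairing of the
      row of L with the column of R.\<close>
    have "p = 0 \<or> b = 0 \<or> q * a = p * b" "q = 0 \<or> a = 0 \<or> q * a = p * b"
      using LR(1,4) unfolding L R by (auto simp: algebra_simps)
    then have eq: "q * a = p * b" by auto
    have "\<exists>u. a = u * p \<and> b = u * q"
    proof (cases "p = 0")
      case True
      then show ?thesis using pq eq by (intro exI[of _ "b / q"]) auto
    next
      case False
      then show ?thesis using eq by (intro exI[of _ "a / p"]) (simp add: field_simps)
    qed
    then obtain u where u: "a = u * p" "b = u * q" by blast
    show thesis using that[of 1 p q "u * u"] unfolding L R u by (simp add: algebra_simps)
  qed
qed

lemma comp_set_subset_range_param: "comp_set c \<subseteq> range (param c)"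
proof
  fix mu assume "mu \<in> comp_set c"
  then have even: "even_struct mu" and eqs: "comp_eqs c mu" by (auto simp: comp_set_def)
  define t where "t p q r s = case_par p q r (s::complex)" for p q r s :: complex
  have t: "t p q r s V1 = p" "t p q r s V2 = q" "t p q r s W1 = r" "t p q r s W2 = s" for p q r s
    by (simp_all add: t_def)
  have "\<exists>u. mu = param c u"
  proof (cases c)
    case C04
    show ?thesis unfolding C04 param.simps
      by (intro exI[of _ "t (mu (F1, F1, E1)) (mu (F1, F2, E1)) (mu (F2, F1, E1)) (mu (F2, F2, E1))"] eq_mkI even)
        (use eqs C04 in \<open>auto simp: deg_eq_1 t comp_defs\<close>)
  next
    case C06
    show ?thesis
    proof (rule nil_multiple[of "mu (E1, F1, F1)" "mu (E1, F2, F1)" "mu (E1, F1, F2)" "mu (E1, F2, F2)"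
          "mu (F1, E1, F1)" "mu (F2, E1, F1)" "mu (F1, E1, F2)" "mu (F2, E1, F2)"])
      fix s u p q
      assume "mu (E1, F1, F1) = s * (p * q)" "mu (E1, F2, F1) = s * (p * p)"
        "mu (E1, F1, F2) = - s * (q * q)" "mu (E1, F2, F2) = - s * (p * q)"
        "mu (F1, E1, F1) = u * (p * q)" "mu (F2, E1, F1) = u * (p * p)"
        "mu (F1, E1, F2) = - u * (q * q)" "mu (F2, E1, F2) = - u * (p * q)"
      then show ?thesis unfolding C06 param.simps
        by (intro exI[of _ "t p q s u"] eq_mkI even) (use eqs C06 in \<open>auto simp: deg_eq_1 t nil_def comp_defs\<close>)
    qed (use eqs C06 in \<open>simp_all add: comp_defs all_idx sum_idx even_structD[OF even] algebra_simps\<close>)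
  next
    case C09
    then have "mu (F1, E1, F1) * mu (F2, E1, F2) = mu (F2, E1, F1) * mu (F1, E1, F2)"
      using eqs by (simp add: comp_defs mult.commute)
    then obtain v1 v2 w1 w2 where
      "mu (F1, E1, F1) = v1 * w1" "mu (F2, E1, F1) = v1 * w2"
      "mu (F1, E1, F2) = v2 * w1" "mu (F2, E1, F2) = v2 * w2"
      by (rule rank1_decomposition)
    then show ?thesis unfolding C09 param.simps
      by (intro exI[of _ "t v1 v2 w1 w2"] eq_mkI even)
        (use eqs C09 in \<open>auto simp: deg_eq_1 t outer_def tr_def comp_defs\<close>)
  next
    case C15
    then have "mu (E1, F1, F1) * mu (E1, F2, F2) = mu (E1, F2, F1) * mu (E1, F1, F2)"
      using eqs by (simp add: comp_defs mult.commute)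
    then obtain v1 v2 w1 w2 where
      "mu (E1, F1, F1) = v1 * w1" "mu (E1, F2, F1) = v1 * w2"
      "mu (E1, F1, F2) = v2 * w1" "mu (E1, F2, F2) = v2 * w2"
      by (rule rank1_decomposition)
    then show ?thesis unfolding C15 param.simps
      by (intro exI[of _ "t v1 v2 w1 w2"] eq_mkI even)
        (use eqs C15 in \<open>auto simp: deg_eq_1 t outer_def tr_def comp_defs\<close>)
  next
    case C17
    then have "mu (E1, F1, F1) * mu (E1, F2, F2) = mu (E1, F2, F1) * mu (E1, F1, F2)"
      using eqs unfolding C17 comp_eqs.simps left_rank1_def by (metis mult.commute)
    then obtain v1 v2 w1 w2 where
      "mu (E1, F1, F1) = v1 * w1" "mu (E1, F2, F1) = v1 * w2"
      "mu (E1, F1, F2) = v2 * w1" "mu (E1, F2, F2) = v2 * w2"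
      by (rule rank1_decomposition)
    moreover have "mu (F1, E1, F1) = mu (E1, F1, F1)" "mu (F2, E1, F1) = mu (E1, F2, F1)"
      "mu (F1, E1, F2) = mu (E1, F1, F2)" "mu (F2, E1, F2) = mu (E1, F2, F2)"
      using eqs unfolding C17 comp_eqs.simps by metis+
    moreover have "mu (E1, E1, E1) = mu (E1, F1, F1) + mu (E1, F2, F2)" "odd_prods_zero mu"
      using eqs unfolding C17 comp_eqs.simps left_rank1_def by metis+
    ultimately show ?thesis unfolding C17 param.simps
      by (intro exI[of _ "t v1 v2 w1 w2"] eq_mkI even)
        (auto simp: deg_eq_1 t outer_def tr_def comp_defs)
  next
    case C19
    show ?thesis unfolding C19 param.simps
      by (intro exI[of _ "t (mu (E1, E1, E1)) 0 1 0"] eq_mkI even)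
        (use eqs C19 in \<open>auto simp: deg_eq_1 t tr_def comp_defs\<close>)
  next
    case C22
    show ?thesis unfolding C22 param.simps
      by (intro exI[of _ "t (mu (E1, E1, E1)) 0 1 0"] eq_mkI even)
        (use eqs C22 in \<open>auto simp: deg_eq_1 t tr_def comp_defs\<close>)
  next
    case C24
    show ?thesis unfolding C24 param.simps
      by (intro exI[of _ "t (mu (E1, E1, E1)) 0 1 0"] eq_mkI even)
        (use eqs C24 in \<open>auto simp: deg_eq_1 t tr_def comp_defs\<close>)
  qed
  then show "mu \<in> range (param c)" by auto
qed

lemma range_param: "range (param c) = comp_set c"
  using comp_set_subset_range_param param_in_comp_set by blast

lemma zirred_comp_set: "zirred (comp_set c)"
  unfolding range_param[symmetric]
  by (rule zirred_range[OF poly_fun_param]) (simp add: range_param zclosed_comp_set)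

section \<open>The variety is the union of the eight sets\<close>

lemma perm_struct_param: "perm_struct (param c t)"
  unfolding perm_struct_iff all_idx sum_idx
  by (cases c; simp add: even_struct_mk outer_def nil_def tr_def algebra_simps)

text \<open>The off-diagonal entries of X X = a X read y (x + w - a) = 0 and z (x + w - a) = 0:
  either the trace is a, and then the determinant is 0, or X is diagonal with entries 0 or
  a.\<close>

lemma quasi_idempotent_cases:
  fixes x y z w a :: complex
  assumes "x * x + y * z = a * x" "x * y + y * w = a * y" "z * x + w * z = a * z" "z * y + w * w = a * w"
  shows "x = 0 \<and> y = 0 \<and> z = 0 \<and> w = 0 \<or> x = a \<and> y = 0 \<and> z = 0 \<and> w = a \<or>
    x * w = y * z \<and> x + w = a"
proof (cases "x + w = a")
  case True
  then have "w = a - x" by (simp add: algebra_simps)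
  then have "x * w = x * (a - x)" by simp
  also have "\<dots> = a * x - x * x" by (simp add: algebra_simps)
  also have "\<dots> = y * z" using assms(1) by (simp add: algebra_simps)
  finally show ?thesis using True by blast
next
  case False
  have "y * (x + w - a) = 0" "z * (x + w - a) = 0" using assms(2,3) by (simp_all add: algebra_simps)
  then have yz: "y = 0" "z = 0" using False by auto
  then have "x = 0 \<or> x = a" "w = 0 \<or> w = a" using assms(1,4) by auto
  then show ?thesis using yz False by auto
qed

text \<open>The other six sets also contain structures with a = 0. The second conjunct places every
  such structure in \<open>C04\<close> or \<open>C06\<close>, where rigidity is refuted
  later.\<close>

lemma perm_struct_in_comp_set:
  assumes perm: "perm_struct mu"
  shows "\<exists>c. mu \<in> comp_set c \<and> (mu (E1, E1, E1) = 0 \<longrightarrow> c = C04 \<or> c = C06)"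
proof -
  have even: "even_struct mu" using perm by (simp add: perm_struct_iff)
  note zero = even_structD[OF even]
  have assoc: "(\<Sum>m\<in>UNIV. mu (i, j, m) * mu (m, l, k)) = (\<Sum>m\<in>UNIV. mu (j, l, m) * mu (i, m, k))"
    and comm: "(\<Sum>m\<in>UNIV. mu (j, l, m) * mu (i, m, k)) =
      (-1) ^ (deg j * deg l) * (\<Sum>m\<in>UNIV. mu (l, j, m) * mu (i, m, k))" for i j l k
    using perm unfolding perm_struct_iff by blast+
  define a where "a = mu (E1, E1, E1)"
  define L where "L j k = mu (E1, j, k)" for j k
  define R where "R j k = mu (j, E1, k)" for j k
  define B where "B i j = mu (i, j, E1)" for i j
  \<comment> \<open>The four relations come from (ee)f = e(ef), e(ef) = e(fe), (ef)e = e(fe) and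
    (fe)e = f(ee). Positional arguments of \<open>comm\<close> follow first occurrence, in the order
    \<open>j l i k\<close>.\<close>
  have LL: "L j F1 * L F1 k + L j F2 * L F2 k = a * L j k"
    and LR: "R j F1 * L F1 k + R j F2 * L F2 k = a * L j k"
    and RL: "L j F1 * R F1 k + L j F2 * R F2 k = a * L j k"
    and RR: "R j F1 * R F1 k + R j F2 * R F2 k = a * R j k"
    if "deg j = 1" "deg k = 1" for j k
    using that assoc[of E1 E1 j k] comm[of E1 j E1 k] assoc[of E1 j E1 k] assoc[of j E1 E1 k]
    unfolding a_def L_def R_def by (simp_all add: sum_idx zero)
  \<comment> \<open>From (ef)f' = e(ff'), (ff')e = f(f'e) and e(ff') = - e(f'f).\<close>
  have BL: "L j F1 * B F1 l + L j F2 * B F2 l = a * B j l"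
    and BR: "R l F1 * B j F1 + R l F2 * B j F2 = a * B j l"
    and B_skew: "a * B j l = - a * B l j"
    if "deg j = 1" "deg l = 1" for j l
    using that assoc[of E1 j l E1] assoc[of j l E1 E1] comm[of j l E1 E1]
    unfolding a_def L_def R_def B_def by (simp_all add: sum_idx zero algebra_simps)
  have BLR: "B j l * L n k = B l n * R j k" and BR_skew: "B l n * R j k = - B n l * R j k"
    if "deg j = 1" "deg l = 1" "deg n = 1" "deg k = 1" for j l n k
    using that assoc[of j l n k] comm[of l n j k]
    unfolding L_def R_def B_def by (simp_all add: sum_idx zero)
  have E1_entries: "L E1 E1 = a" "R E1 E1 = a" "B E1 E1 = a" "L E1 F1 = 0" "L E1 F2 = 0" "L F1 E1 = 0"
    "L F2 E1 = 0" "R E1 F1 = 0" "R E1 F2 = 0" "R F1 E1 = 0" "R F2 E1 = 0"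
    unfolding L_def R_def B_def a_def by (simp_all add: zero)
  show ?thesis
  proof (cases "a = 0")
    case a: True
    show ?thesis
    proof (cases "B F1 F1 = 0 \<and> B F1 F2 = 0 \<and> B F2 F1 = 0 \<and> B F2 F2 = 0")
      case True
      have "comp_eqs C06 mu"
        using True a LL LR RL RR
        by (simp add: comp_defs all_idx sum_idx E1_entries flip: a_def L_def R_def B_def)
      then show ?thesis using even unfolding comp_set_def by blast
    next
      case False
      \<comment> \<open>A nonzero entry of \<open>R\<close> makes \<open>B\<close> skew, hence
        nondegenerate as \<open>B\<close> is not 0; then B(f, R f') = a B(f, f') = 0 forces R =
        0.\<close>
      have R0: "R j k = 0" if j: "deg j = 1" and k: "deg k = 1" for j k
      proof (rule ccontr)
        assume "R j k \<noteq> 0"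
        then have skew: "B l n = - B n l" if "deg l = 1" "deg n = 1" for l n
          using BR_skew[OF j that k] by (metis mult_cancel_right mult_minus_left)
        have "B F1 F1 = 0" "B F2 F2 = 0" "B F2 F1 = - B F1 F2"
          using skew[of F1 F1] skew[of F2 F2] skew[of F2 F1] by auto
        with False BR[of F1 j] BR[of F2 j] a j have "R j F1 = 0 \<and> R j F2 = 0" by auto
        then show False using \<open>R j k \<noteq> 0\<close> k by (cases k) auto
      qed
      have L0: "L n k = 0" if "deg n = 1" "deg k = 1" for n k
        using BLR[of F1 F1 n k] BLR[of F1 F2 n k] BLR[of F2 F1 n k] BLR[of F2 F2 n k] False that
        by (auto simp: R0)
      have "comp_eqs C04 mu" using a L0 R0 by (simp add: comp_defs E1_entries flip: a_def L_def R_def B_def)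
      then show ?thesis using even unfolding comp_set_def by blast
    qed
  next
    case a: False
    have B_skew: "B j l = - B l j" if "deg j = 1" "deg l = 1" for j l
      using B_skew[OF that] a by (simp flip: mult_minus_right)
    have B0: "B F1 F1 = 0" "B F2 F2 = 0" "B F2 F1 = - B F1 F2"
      using B_skew[of F1 F1] B_skew[of F2 F2] B_skew[of F2 F1] by auto
    \<comment> \<open>\<open>BL\<close> gives L11 B12 = a B12, while \<open>BLR\<close> gives B21
      L11 = 0 because B11 = 0.\<close>
    then have "B F1 F2 = 0" using BL[of F1 F2] BLR[of F2 F1 F1 F1] a by auto
    with B0 have odd: "odd_prods_zero mu" by (simp add: odd_prods_zero_def flip: B_def)
    have Lc: "left_scalar 0 mu \<or> left_scalar a mu \<or> left_rank1 mu"
      using quasi_idempotent_cases[of "L F1 F1" "L F1 F2" "L F2 F1" a "L F2 F2"] LL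
      by (simp add: left_scalar_def left_rank1_def E1_entries flip: L_def)
    have Rc: "right_scalar 0 mu \<or> right_scalar a mu \<or> right_rank1 mu"
      using quasi_idempotent_cases[of "R F1 F1" "R F1 F2" "R F2 F1" a "R F2 F2"] RR
      by (simp add: right_scalar_def right_rank1_def E1_entries flip: R_def)
    have eq: "L j k = R j k" if rank1: "left_rank1 mu" "right_rank1 mu" and "deg j = 1" "deg k = 1" for j k
    proof -
      \<comment> \<open>The relations give D D = a D for D = R - L. Equal traces of L and R leave
        trace 0, whereas a nonzero solution has trace a or 2a.\<close>
      define D where "D j k = R j k - L j k" for j k
      have D: "D j F1 * D F1 k + D j F2 * D F2 k = a * D j k" if "deg j = 1" "deg k = 1" for j k
        using LL[OF that] LR[OF that] RL[OF that] RR[OF that] unfolding D_def by (simp add: algebra_simps)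
      have "D F1 F1 + D F2 F2 = 0"
        using rank1 unfolding left_rank1_def right_rank1_def D_def L_def R_def by (simp add: algebra_simps)
      then have "D F1 F1 = 0 \<and> D F1 F2 = 0 \<and> D F2 F1 = 0 \<and> D F2 F2 = 0"
        using quasi_idempotent_cases[of "D F1 F1" "D F1 F2" "D F2 F1" a "D F2 F2"] D a by auto
      then show ?thesis using that(3,4) by (cases j; cases k) (auto simp: D_def)
    qed
    have "\<exists>c. comp_eqs c mu"
      using Lc
    proof (elim disjE)
      assume L: "left_scalar 0 mu"
      then have "comp_eqs C19 mu \<or> comp_eqs C22 mu \<or> comp_eqs C09 mu"
        using Rc odd by (auto simp: a_def)
      then show ?thesis by blast
    next
      assume L: "left_scalar a mu"
      then have "right_scalar a mu"
        using a RL[of F1 F1] RL[of F1 F2] RL[of F2 F1] RL[of F2 F2]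
        by (simp add: left_scalar_def right_scalar_def flip: L_def R_def)
      then have "comp_eqs C24 mu" using L odd by (simp add: a_def)
      then show ?thesis by blast
    next
      assume L: "left_rank1 mu"
      have "\<not> right_scalar 0 mu"
      proof
        assume "right_scalar 0 mu"
        then have "L F1 F1 = 0" "L F2 F2 = 0"
          using RL[of F1 F1] RL[of F2 F2] a by (auto simp: right_scalar_def simp flip: R_def)
        then show False using L a by (simp add: left_rank1_def E1_entries flip: L_def)
      qed
      then have "right_scalar a mu \<or> right_rank1 mu" using Rc by blast
      then show ?thesis
      proof
        assume "right_scalar a mu"
        then have "comp_eqs C15 mu" using L odd by (simp add: a_def)
        then show ?thesis by blast
      next
        assume right: "right_rank1 mu"
        have "\<forall>j k. L j k = R j k"
          unfolding all_idx using eq[OF L right] by (simp add: E1_entries)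
        then have "\<forall>j k. mu (E1, j, k) = mu (j, E1, k)" unfolding L_def R_def .
        then have "comp_eqs C17 mu" using L odd by simp
        then show ?thesis by blast
      qed
    qed
    then show ?thesis using even a unfolding comp_set_def a_def by blast
  qed
qed

lemma perm_variety_eq: "perm_variety = (\<Union>c. comp_set c)"
proof
  show "perm_variety \<subseteq> (\<Union>c. comp_set c)"
    using perm_struct_in_comp_set unfolding perm_variety_def by blast
  show "(\<Union>c. comp_set c) \<subseteq> perm_variety"
    using perm_struct_param unfolding perm_variety_def range_param[symmetric] by blast
qed

text \<open>For \<open>R06\<close> the parameter must avoid 0, 1 and -1, where the structure also
  lies in \<open>C17\<close>, \<open>C15\<close> or \<open>C09\<close> respectively. Every parameter
  works for \<open>R04\<close>.\<close>

fun witness :: "comp \<Rightarrow> sstruct" where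
  "witness C04 = R04 2" | "witness C06 = R06 2" | "witness C09 = R09" | "witness C15 = R15"
| "witness C17 = R17" | "witness C19 = R19" | "witness C22 = R22" | "witness C24 = R24"

lemmas R_defs = R04_def R06_def R09_def R15_def R17_def R19_def R22_def R24_def

lemma witness_iff: "witness c \<in> comp_set d \<longleftrightarrow> c = d"
proof -
  have "even_struct (witness c)"
    unfolding even_struct_def all_idx by (cases c) (simp_all add: R_defs)
  then show ?thesis
    unfolding comp_set_def by (cases c; cases d; simp add: R_defs comp_defs all_idx sum_idx)
qed

lemma irr_components_perm_variety: "irr_components perm_variety = range comp_set"
  unfolding perm_variety_eq by (rule irr_components_UN[OF zirred_comp_set witness_iff])

lemma inj_comp_set: "inj comp_set"
  using witness_iff by (metis injI)

section \<open>Orbits\<close>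

lemma orbitI: "even_lin g \<Longrightarrow> mat_mul g h = mat_id \<Longrightarrow> mat_mul h g = mat_id \<Longrightarrow> act g h mu \<in> orbit mu"
  unfolding orbit_def by blast

lemma inverse_entries:
  assumes "even_lin g" and gh: "mat_mul g h = mat_id" and hg: "mat_mul h g = mat_id"
  shows "g E1 F1 = 0" "g E1 F2 = 0" "g F1 E1 = 0" "g F2 E1 = 0"
    "h E1 F1 = 0" "h E1 F2 = 0" "h F1 E1 = 0" "h F2 E1 = 0"
    "g E1 E1 * h E1 E1 = 1"
    "g F1 F1 * h F1 F1 + g F1 F2 * h F2 F1 = 1" "g F1 F1 * h F1 F2 + g F1 F2 * h F2 F2 = 0"
    "g F2 F1 * h F1 F1 + g F2 F2 * h F2 F1 = 0" "g F2 F1 * h F1 F2 + g F2 F2 * h F2 F2 = 1"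
    "h F1 F1 * g F1 F1 + h F1 F2 * g F2 F1 = 1" "h F1 F1 * g F1 F2 + h F1 F2 * g F2 F2 = 0"
    "h F2 F1 * g F1 F1 + h F2 F2 * g F2 F1 = 0" "h F2 F1 * g F1 F2 + h F2 F2 * g F2 F2 = 1"
proof -
  show g0: "g E1 F1 = 0" "g E1 F2 = 0" "g F1 E1 = 0" "g F2 E1 = 0"
    using assms(1) unfolding even_lin_def by (metis deg.simps zero_neq_one)+
  have gh: "g i E1 * h E1 j + g i F1 * h F1 j + g i F2 * h F2 j = (if i = j then 1 else 0)"
    and hg: "h i E1 * g E1 j + h i F1 * g F1 j + h i F2 * g F2 j = (if i = j then 1 else 0)" for i j
    using fun_cong[OF fun_cong[OF gh, of i], of j] fun_cong[OF fun_cong[OF hg, of i], of j]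
    by (simp_all add: mat_mul_def mat_id_def sum_idx)
  show e: "g E1 E1 * h E1 E1 = 1" using gh[of E1 E1] g0 by simp
  show h0: "h E1 F1 = 0" "h E1 F2 = 0" "h F1 E1 = 0" "h F2 E1 = 0"
    using gh[of E1 F1] gh[of E1 F2] hg[of F1 E1] hg[of F2 E1] g0 e by auto
  show "g F1 F1 * h F1 F1 + g F1 F2 * h F2 F1 = 1" "g F1 F1 * h F1 F2 + g F1 F2 * h F2 F2 = 0"
    "g F2 F1 * h F1 F1 + g F2 F2 * h F2 F1 = 0" "g F2 F1 * h F1 F2 + g F2 F2 * h F2 F2 = 1"
    using gh[of F1 F1] gh[of F1 F2] gh[of F2 F1] gh[of F2 F2] g0 by simp_all
  show "h F1 F1 * g F1 F1 + h F1 F2 * g F2 F1 = 1" "h F1 F1 * g F1 F2 + h F1 F2 * g F2 F2 = 0"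
    "h F2 F1 * g F1 F1 + h F2 F2 * g F2 F1 = 0" "h F2 F1 * g F1 F2 + h F2 F2 * g F2 F2 = 1"
    using hg[of F1 F1] hg[of F1 F2] hg[of F2 F1] hg[of F2 F2] g0 by simp_all
qed

lemma act_act: "act g h (act g' h' mu) = act (mat_mul g g') (mat_mul h' h) mu"
proof -
  \<comment> \<open>\<open>A1\<close>, \<open>A2\<close>, \<open>A3\<close> transform one index each
    and commute, which reduces the composition law to three separate identities about single
    sums.\<close>
  define A1 where "A1 u nu = (\<lambda>(i, j, k). \<Sum>p\<in>UNIV. u p i * nu (p, j, k))"
    for u :: mat and nu :: sstruct
  define A2 where "A2 u nu = (\<lambda>(i, j, k). \<Sum>q\<in>UNIV. u q j * nu (i, q, k))"
    for u :: mat and nu :: sstruct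
  define A3 where "A3 u nu = (\<lambda>(i, j, k). \<Sum>r\<in>UNIV. nu (i, j, r) * u k r)"
    for u :: mat and nu :: sstruct
  have act: "act u v nu = A1 v (A2 v (A3 u nu))" for u v nu
    by (simp add: act_def A1_def A2_def A3_def fun_eq_iff sum_distrib_left mult.assoc)
  have A11: "A1 u (A1 v nu) = A1 (mat_mul v u) nu" for u v nu
    by (simp add: A1_def mat_mul_def fun_eq_iff sum_idx algebra_simps)
  have A22: "A2 u (A2 v nu) = A2 (mat_mul v u) nu" for u v nu
    by (simp add: A2_def mat_mul_def fun_eq_iff sum_idx algebra_simps)
  have A33: "A3 u (A3 v nu) = A3 (mat_mul u v) nu" for u v nu
    by (simp add: A3_def mat_mul_def fun_eq_iff sum_idx algebra_simps)
  have A21: "A2 u (A1 v nu) = A1 v (A2 u nu)" for u v nu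
    by (simp add: A1_def A2_def fun_eq_iff sum_idx algebra_simps)
  have A31: "A3 u (A1 v nu) = A1 v (A3 u nu)" for u v nu
    by (simp add: A1_def A3_def fun_eq_iff sum_idx algebra_simps)
  have A32: "A3 u (A2 v nu) = A2 v (A3 u nu)" for u v nu
    by (simp add: A2_def A3_def fun_eq_iff sum_idx algebra_simps)
  show ?thesis unfolding act A31 A32 A21 A11 A22 A33 ..
qed

lemma mat_mul_assoc: "mat_mul (mat_mul u v) w = mat_mul u (mat_mul v w)"
  by (simp add: mat_mul_def fun_eq_iff sum_idx algebra_simps)

lemma mat_mul_id: "mat_mul mat_id u = u" "mat_mul u mat_id = u"
proof -
  show "mat_mul mat_id u = u"
  proof (intro ext)
    show "mat_mul mat_id u i j = u i j" for i j by (cases i) (simp_all add: mat_mul_def mat_id_def sum_idx)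
  qed
  show "mat_mul u mat_id = u"
  proof (intro ext)
    show "mat_mul u mat_id i j = u i j" for i j by (cases j) (simp_all add: mat_mul_def mat_id_def sum_idx)
  qed
qed

lemma act_id: "act mat_id mat_id mu = mu"
proof (rule ext)
  fix x :: "idx \<times> idx \<times> idx"
  obtain i j k where "x = (i, j, k)" by (cases x)
  then show "act mat_id mat_id mu x = mu x"
    by (cases i; cases j; cases k; simp add: act_def sum_idx mat_id_def)
qed

lemma even_lin_mat_id: "even_lin mat_id"
  by (simp add: even_lin_def mat_id_def)

lemma even_lin_inverse:
  assumes "even_lin g" and "mat_mul g h = mat_id" and "mat_mul h g = mat_id"
  shows "even_lin h"
  unfolding even_lin_def all_idx by (simp add: inverse_entries[OF assms])

lemma even_lin_mat_mul: "even_lin g \<Longrightarrow> even_lin h \<Longrightarrow> even_lin (mat_mul g h)"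
  unfolding even_lin_def all_idx by (auto simp: mat_mul_def sum_idx)

lemma orbit_refl: "mu \<in> orbit mu"
  using orbitI[OF even_lin_mat_id, of mat_id mu] by (simp add: mat_mul_id act_id)

lemma orbit_subset:
  assumes "nu \<in> orbit mu"
  shows "orbit nu \<subseteq> orbit mu"
proof
  fix x assume "x \<in> orbit nu"
  then obtain g h where x: "x = act g h nu" and g: "even_lin g" "mat_mul g h = mat_id" "mat_mul h g = mat_id"
    unfolding orbit_def by blast
  obtain g' h' where nu: "nu = act g' h' mu"
    and g': "even_lin g'" "mat_mul g' h' = mat_id" "mat_mul h' g' = mat_id"
    using assms unfolding orbit_def by blast
  have "mat_mul (mat_mul g g') (mat_mul h' h) = mat_id"
    by (metis mat_mul_assoc mat_mul_id(1) g(2) g'(2))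
  moreover have "mat_mul (mat_mul h' h) (mat_mul g g') = mat_id"
    by (metis mat_mul_assoc mat_mul_id(1) g(3) g'(3))
  ultimately show "x \<in> orbit mu" unfolding x nu act_act
    by (intro orbitI even_lin_mat_mul g(1) g'(1))
qed

lemma orbit_sym:
  assumes "nu \<in> orbit mu"
  shows "mu \<in> orbit nu"
proof -
  obtain g h where nu: "nu = act g h mu"
    and g: "even_lin g" "mat_mul g h = mat_id" "mat_mul h g = mat_id"
    using assms unfolding orbit_def by blast
  have "act h g nu = mu" unfolding nu act_act by (simp add: g act_id)
  then show ?thesis using orbitI[OF even_lin_inverse[OF g] g(3) g(2), of nu] by simp
qed

lemma orbit_eq: "nu \<in> orbit mu \<Longrightarrow> orbit nu = orbit mu"
  using orbit_subset orbit_sym by blast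

definition blockmat :: "complex \<Rightarrow> mat \<Rightarrow> mat" where
  "blockmat e m = (\<lambda>i j. if i = E1 \<and> j = E1 then e else m i j)"

lemma blockmat_act_in_orbit:
  assumes "e * e' = 1" and "p * p' + q * r' = 1" "p * q' + q * s' = 0" "r * p' + s * r' = 0" "r * q' + s * s' = 1"
    and "p' * p + q' * r = 1" "p' * q + q' * s = 0" "r' * p + s' * r = 0" "r' * q + s' * s = 1"
  shows "act (blockmat e (mat2 p q r s)) (blockmat e' (mat2 p' q' r' s')) mu \<in> orbit mu"
proof (rule orbitI)
  show "even_lin (blockmat e (mat2 p q r s))"
    unfolding even_lin_def all_idx by (simp add: blockmat_def)
  show "mat_mul (blockmat e (mat2 p q r s)) (blockmat e' (mat2 p' q' r' s')) = mat_id"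
  proof (intro ext)
    show "mat_mul (blockmat e (mat2 p q r s)) (blockmat e' (mat2 p' q' r' s')) i j = mat_id i j" for i j
      using assms by (cases i; cases j) (simp_all add: mat_mul_def mat_id_def blockmat_def sum_idx)
  qed
  show "mat_mul (blockmat e' (mat2 p' q' r' s')) (blockmat e (mat2 p q r s)) = mat_id"
  proof (intro ext)
    show "mat_mul (blockmat e' (mat2 p' q' r' s')) (blockmat e (mat2 p q r s)) i j = mat_id i j" for i j
      using assms by (cases i; cases j) (simp_all add: mat_mul_def mat_id_def blockmat_def sum_idx mult.commute)
  qed
qed

section \<open>The six orbits with a \<noteq> 0\<close>

definition rigid_comps :: "comp set" where
  "rigid_comps = {C09, C15, C17, C19, C22, C24}"

lemma act_even:
  assumes "even_lin g" "mat_mul g h = mat_id" "mat_mul h g = mat_id" "even_struct mu"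
  shows "even_struct (act g h mu)"
  using inverse_entries[OF assms(1-3)] even_structD[OF assms(4)]
  unfolding even_struct_def all_idx act_def by (simp add: sum_idx)

text \<open>In each witness \<open>L\<close> and \<open>R\<close> are 0, the identity or the
  projection onto \<open>F1\<close>. Conjugation keeps the identity and turns the projection into
  column \<open>F1\<close> of g times row \<open>F1\<close> of h; everything is scaled by
  \<open>h E1 E1\<close>, which is absorbed into the column. The row times the unscaled column is 1,
  whence the trace.\<close>

lemma act_witness_eq_param:
  assumes c: "c \<in> rigid_comps"
    and g: "even_lin g" "mat_mul g h = mat_id" "mat_mul h g = mat_id"
  defines "t \<equiv> case_par (h E1 E1 * g F1 F1) (h E1 E1 * g F2 F1) (h F1 F1) (h F1 F2)"
  shows "act g h (witness c) = param c t" and "tr t = h E1 E1"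
proof -
  note inv = inverse_entries[OF g]
  have t: "t V1 = h E1 E1 * g F1 F1" "t V2 = h E1 E1 * g F2 F1" "t W1 = h F1 F1" "t W2 = h F1 F2"
    by (simp_all add: t_def)
  have "tr t = h E1 E1 * (h F1 F1 * g F1 F1 + h F1 F2 * g F2 F1)"
    unfolding tr_def t by (simp add: algebra_simps)
  then show tr: "tr t = h E1 E1" by (simp add: inv)
  have e: "h E1 E1 * (h E1 E1 * g E1 E1) = h E1 E1" using inv(9) by (simp add: mult.commute)
  have G: "g i F1 * (h E1 E1 * h F1 j) + g i F2 * (h E1 E1 * h F2 j)
      = h E1 E1 * (g i F1 * h F1 j + g i F2 * h F2 j)" for i j
    by (simp add: algebra_simps)
  have even: "even_struct (act g h (witness c))"
    using witness_iff[of c c] by (intro act_even g) (simp add: comp_set_def)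
  have "\<exists>a L R B. param c t = mk a L R B" by (cases c) auto
  then have even': "even_struct (param c t)" using even_struct_mk by auto
  show "act g h (witness c) = param c t"
  proof
    fix x :: "idx \<times> idx \<times> idx"
    obtain i j k where x: "x = (i, j, k)" by (cases x)
    show "act g h (witness c) x = param c t x"
    proof (cases "deg k = (deg i + deg j) mod 2")
      case False
      then show ?thesis unfolding x using even_structD[OF even] even_structD[OF even'] by metis
    next
      case True
      then show ?thesis unfolding x using c
        by (cases i; cases j; cases k)
          (auto simp: rigid_comps_def act_def sum_idx inv R_defs tr outer_def t e G inv mult_ac)
    qed
  qed
qed

lemma param_in_orbit_witness:
  assumes c: "c \<in> rigid_comps" and "tr t \<noteq> 0"
  shows "param c t \<in> orbit (witness c)"
proof -
  define a where "a = tr t"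
  have a: "a \<noteq> 0" "t V1 * t W1 + t V2 * t W2 = a" using assms(2) by (simp_all add: a_def tr_def)
  \<comment> \<open>The column v / a is completed by (-W2, W1), which spans the kernel of w. The
    determinant is w v / a = 1, so the inverse has rows w and (-V2, V1) / a.\<close>
  define g where "g = blockmat (1 / a) (mat2 (t V1 / a) (- t W2) (t V2 / a) (t W1))"
  define h where "h = blockmat a (mat2 (t W1) (t W2) (- t V2 / a) (t V1 / a))"
  have g: "even_lin g" unfolding even_lin_def all_idx by (simp add: blockmat_def g_def)
  have "mat_mul g h = mat_id"
  proof (intro ext)
    show "mat_mul g h i j = mat_id i j" for i j
      using a by (cases i; cases j)
        (simp_all add: g_def h_def mat_mul_def mat_id_def blockmat_def sum_idx field_simps)
  qed
  moreover have "mat_mul h g = mat_id"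
  proof (intro ext)
    show "mat_mul h g i j = mat_id i j" for i j
      using a by (cases i; cases j)
        (simp_all add: g_def h_def mat_mul_def mat_id_def blockmat_def sum_idx field_simps)
  qed
  moreover note g
  ultimately have inv: "mat_mul g h = mat_id" "mat_mul h g = mat_id" by blast+
  define u where "u = case_par (h E1 E1 * g F1 F1) (h E1 E1 * g F2 F1) (h F1 F1) (h F1 F2)"
  have "u = t"
  proof
    show "u x = t x" for x using a by (cases x) (simp_all add: u_def g_def h_def blockmat_def)
  qed
  then have "act g h (witness c) = param c t"
    using act_witness_eq_param(1)[OF c g inv] unfolding u_def by simp
  then show ?thesis using orbitI[OF g inv, of "witness c"] by simp
qed

section \<open>Density, rigidity and dimension\<close>

lemma orbit_witness:
  assumes "c \<in> rigid_comps"
  shows "orbit (witness c) = {mu \<in> comp_set c. mu (E1, E1, E1) \<noteq> 0}"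
proof
  have E1: "param c t (E1, E1, E1) = tr t" for t using assms by (auto simp: rigid_comps_def)
  show "orbit (witness c) \<subseteq> {mu \<in> comp_set c. mu (E1, E1, E1) \<noteq> 0}"
  proof
    fix x assume "x \<in> orbit (witness c)"
    then obtain g h where x: "x = act g h (witness c)"
      and g: "even_lin g" "mat_mul g h = mat_id" "mat_mul h g = mat_id"
      unfolding orbit_def by blast
    have "h E1 E1 \<noteq> 0" using inverse_entries(9)[OF g] by auto
    then show "x \<in> {mu \<in> comp_set c. mu (E1, E1, E1) \<noteq> 0}"
      unfolding x act_witness_eq_param(1)[OF assms g]
      using param_in_comp_set act_witness_eq_param(2)[OF assms g] by (simp add: E1)
  qed
  show "{mu \<in> comp_set c. mu (E1, E1, E1) \<noteq> 0} \<subseteq> orbit (witness c)"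
    using param_in_orbit_witness[OF assms] E1 unfolding range_param[symmetric] by auto
qed

lemma zclosure_orbit_witness:
  assumes "c \<in> rigid_comps"
  shows "zclosure (orbit (witness c)) = comp_set c"
proof
  show "zclosure (orbit (witness c)) \<subseteq> comp_set c"
    by (rule zclosure_minimal) (auto simp: orbit_witness[OF assms] zclosed_comp_set)
  have "tr \<in> poly_fun" unfolding tr_def[abs_def] by (intro poly_fun_intros)
  moreover have "tr (\<lambda>_. 1) \<noteq> 0" by (simp add: tr_def)
  ultimately show "comp_set c \<subseteq> zclosure (orbit (witness c))"
    unfolding range_param[symmetric]
    by (rule range_subset_zclosure[OF poly_fun_param]) (rule param_in_orbit_witness[OF assms])
qed

text \<open>The scalar matrices 0 and a have traces 0 and 2a; these agree with each other or with
  the trace a of the rank-one type only if a = 0.\<close>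

lemma comp_set_disjoint:
  assumes "c \<in> rigid_comps" and "c \<noteq> d" and "mu \<in> comp_set c" and "mu \<in> comp_set d"
  shows "mu (E1, E1, E1) = 0"
proof -
  have "comp_eqs c mu" "comp_eqs d mu" using assms(3,4) by (auto simp: comp_set_def)
  then show ?thesis
    using assms(1,2) unfolding rigid_comps_def
    by (cases d) (auto simp: comp_defs all_idx)
qed

lemma rigid_witness:
  assumes "c \<in> rigid_comps"
  shows "rigid_in perm_variety (witness c)"
  unfolding rigid_in_def
proof (intro conjI exI)
  let ?F = "{mu. mu (E1, E1, E1) = 0} \<union> (\<Union>d\<in>-{c}. comp_set d)"
  show "witness c \<in> perm_variety" unfolding perm_variety_eq using witness_iff by blast
  show "zclosed ?F"
    by (intro zclosed_Un zclosed_eq zclosed_UN poly_fun_intros zclosed_comp_set) simp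
  have "c = d" if "mu \<in> comp_set c" "mu \<in> comp_set d" "mu (E1, E1, E1) \<noteq> 0" for mu d
    using comp_set_disjoint[OF assms _ that(1,2)] that(3) by blast
  then show "orbit (witness c) = perm_variety - ?F"
    unfolding orbit_witness[OF assms] perm_variety_eq by blast
qed

section \<open>Non-rigidity in the two sets with a = 0\<close>

definition sym_disc :: "sstruct \<Rightarrow> complex" where
  "sym_disc mu = 4 * mu (F1, F1, E1) * mu (F2, F2, E1) - (mu (F1, F2, E1) + mu (F2, F1, E1))\<^sup>2"

definition skew_disc :: "sstruct \<Rightarrow> complex" where
  "skew_disc mu = (mu (F1, F2, E1) - mu (F2, F1, E1))\<^sup>2"

lemma act_odd_prods:
  assumes "even_lin g" "mat_mul g h = mat_id" "mat_mul h g = mat_id" "even_struct mu"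
  shows "deg i = 1 \<Longrightarrow> deg j = 1 \<Longrightarrow> act g h mu (i, j, E1) = g E1 E1 *
    (h F1 i * h F1 j * mu (F1, F1, E1) + h F1 i * h F2 j * mu (F1, F2, E1) +
     h F2 i * h F1 j * mu (F2, F1, E1) + h F2 i * h F2 j * mu (F2, F2, E1))"
  using inverse_entries[OF assms(1-3)] even_structD[OF assms(4)]
  by (cases i; cases j; simp add: act_def sum_idx algebra_simps)

text \<open>\<open>sym_disc\<close> and \<open>skew_disc\<close> are the determinants of B + B^T and
  B - B^T. The action replaces B by g_E h^T B h, with g_E = \<open>g E1 E1\<close> and h the odd
  block, so both determinants acquire the same factor.\<close>

lemma disc_act:
  assumes "even_lin g" "mat_mul g h = mat_id" "mat_mul h g = mat_id" "even_struct mu"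
  shows "sym_disc (act g h mu) = (g E1 E1 * (h F1 F1 * h F2 F2 - h F1 F2 * h F2 F1))\<^sup>2 * sym_disc mu"
    and "skew_disc (act g h mu) = (g E1 E1 * (h F1 F1 * h F2 F2 - h F1 F2 * h F2 F1))\<^sup>2 * skew_disc mu"
proof -
  show "sym_disc (act g h mu) = (g E1 E1 * (h F1 F1 * h F2 F2 - h F1 F2 * h F2 F1))\<^sup>2 * sym_disc mu"
    unfolding sym_disc_def by (simp add: act_odd_prods[OF assms] power2_eq_square) algebra
  show "skew_disc (act g h mu) = (g E1 E1 * (h F1 F1 * h F2 F2 - h F1 F2 * h F2 F1))\<^sup>2 * skew_disc mu"
    unfolding skew_disc_def by (simp add: act_odd_prods[OF assms] power2_eq_square) algebra
qed

text \<open>An open orbit that meets an irreducible \<open>Z\<close> is dense in \<open>Z\<close>,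
  so it cannot lie in a closed set that misses part of \<open>Z\<close>.\<close>

lemma not_rigid:
  assumes "zirred Z" "Z \<subseteq> X" "mu \<in> Z" and C: "zclosed C" "orbit mu \<subseteq> C" "\<not> Z \<subseteq> C"
  shows "\<not> rigid_in X mu"
proof
  assume "rigid_in X mu"
  then obtain F where F: "zclosed F" "orbit mu = X - F" unfolding rigid_in_def by blast
  have "Z \<subseteq> F \<union> C" using F(2) assms(2) C(2) by blast
  then have "Z \<subseteq> F" using assms(1) F(1) C(1,3) unfolding zirred_def by blast
  then show False using orbit_refl[of mu] F(2) assms(3) by blast
qed

lemma not_rigid_C04:
  assumes mu: "mu \<in> comp_set C04"
  shows "\<not> rigid_in perm_variety mu"
proof -
  have even: "even_struct mu" using mu by (simp add: comp_set_def)
  \<comment> \<open>(x, y) holds the ratio of the two discriminants. When both vanish, the equation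
    of \<open>?C\<close> is satisfied for any pair, and (0, 1) is a placeholder.\<close>
  obtain x y where xy: "x \<noteq> 0 \<or> y \<noteq> 0" and mu_xy: "sym_disc mu * y = skew_disc mu * x"
  proof (cases "sym_disc mu = 0 \<and> skew_disc mu = 0")
    case True
    then show thesis using that[of 0 1] by simp
  next
    case False
    then show thesis using that[of "sym_disc mu" "skew_disc mu"] by (auto simp: mult.commute)
  qed
  let ?C = "{nu. sym_disc nu * y = skew_disc nu * x}"
  show ?thesis
  proof (rule not_rigid[OF zirred_comp_set _ mu])
    show "comp_set C04 \<subseteq> perm_variety" unfolding perm_variety_eq by blast
    show "zclosed ?C"
      unfolding sym_disc_def skew_disc_def by (intro zclosed_eq poly_fun_intros)
    show "orbit mu \<subseteq> ?C"
    proof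
      fix nu assume "nu \<in> orbit mu"
      then obtain g h where nu: "nu = act g h mu"
        and g: "even_lin g" "mat_mul g h = mat_id" "mat_mul h g = mat_id"
        unfolding orbit_def by blast
      show "nu \<in> ?C" unfolding nu mem_Collect_eq disc_act[OF g even] mult.assoc mu_xy ..
    qed
    show "\<not> comp_set C04 \<subseteq> ?C"
    proof
      assume sub: "comp_set C04 \<subseteq> ?C"
      \<comment> \<open>The discriminant pairs of these two forms are (-4, 0) and (0, 4), so
        membership in \<open>?C\<close> would force y = 0 and x = 0.\<close>
      have "param C04 (case_par 0 1 1 0) \<in> ?C" "param C04 (case_par 0 1 (-1) 0) \<in> ?C"
        using sub param_in_comp_set by blast+
      then show False using xy by (auto simp: sym_disc_def skew_disc_def)
    qed
  qed
qed

lemma not_rigid_C06: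
  assumes mu: "mu \<in> comp_set C06"
  shows "\<not> rigid_in perm_variety mu"
proof -
  obtain t where t: "mu = param C06 t" using mu unfolding range_param[symmetric] by blast
  obtain x y where xy: "x \<noteq> 0 \<or> y \<noteq> 0" and "t W1 * y = t W2 * x"
  proof (cases "t W1 = 0 \<and> t W2 = 0")
    case True
    then show thesis using that[of 0 1] by simp
  next
    case False
    then show thesis using that[of "t W1" "t W2"] by (auto simp: mult.commute)
  qed
  then have mu_xy: "mu (E1, j, k) * y = mu (j, E1, k) * x" if "deg j = 1" "deg k = 1" for j k
    using that unfolding t by (cases j; cases k) (simp_all add: nil_def)
  \<comment> \<open>The relation L y = R x is inherited by the whole orbit. This one entry of it is
    enough, because it is s p p in \<open>nil s p q\<close> and does not vanish identically.\<close>
  let ?C = "{nu :: sstruct. nu (E1, F2, F1) * y = nu (F2, E1, F1) * x}"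
  show ?thesis
  proof (rule not_rigid[OF zirred_comp_set _ mu])
    show "comp_set C06 \<subseteq> perm_variety" unfolding perm_variety_eq by blast
    show "zclosed ?C" by (intro zclosed_eq poly_fun_intros)
    show "orbit mu \<subseteq> ?C"
    proof
      fix nu assume "nu \<in> orbit mu"
      then obtain g h where nu: "nu = act g h mu"
        and g: "even_lin g" "mat_mul g h = mat_id" "mat_mul h g = mat_id"
        unfolding orbit_def by blast
      note inv = inverse_entries[OF g]
      have even: "even_struct mu" using mu by (simp add: comp_set_def)
      have left: "nu (E1, F2, F1) = h E1 E1 * (\<Sum>j\<in>{F1, F2}. \<Sum>k\<in>{F1, F2}. h j F2 * g F1 k * mu (E1, j, k))"
        and right: "nu (F2, E1, F1) = h E1 E1 * (\<Sum>j\<in>{F1, F2}. \<Sum>k\<in>{F1, F2}. h j F2 * g F1 k * mu (j, E1, k))"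
        unfolding nu by (simp_all add: act_def sum_idx inv even_structD[OF even] algebra_simps)
      have "nu (E1, F2, F1) * y = nu (F2, E1, F1) * x"
        unfolding left right mult.assoc sum_distrib_right
        by (intro arg_cong[where f="(*) (h E1 E1)"] sum.cong refl) (auto simp: mu_xy)
      then show "nu \<in> ?C" by simp
    qed
    show "\<not> comp_set C06 \<subseteq> ?C"
    proof
      assume sub: "comp_set C06 \<subseteq> ?C"
      have "param C06 (case_par 1 0 1 0) \<in> ?C" "param C06 (case_par 1 0 0 1) \<in> ?C"
        using sub param_in_comp_set by blast+
      then show False using xy by (auto simp: nil_def)
    qed
  qed
qed

lemma rigid_orbits:
  "{orbit mu | mu. rigid_in perm_variety mu} = (\<lambda>c. orbit (witness c)) ` rigid_comps"
proof
  show "(\<lambda>c. orbit (witness c)) ` rigid_comps \<subseteq> {orbit mu | mu. rigid_in perm_variety mu}"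
    using rigid_witness by blast
  show "{orbit mu | mu. rigid_in perm_variety mu} \<subseteq> (\<lambda>c. orbit (witness c)) ` rigid_comps"
  proof
    fix Q assume "Q \<in> {orbit mu | mu. rigid_in perm_variety mu}"
    then obtain mu where Q: "Q = orbit mu" and rigid: "rigid_in perm_variety mu" by blast
    then have "perm_struct mu" by (simp add: rigid_in_def perm_variety_def)
    then obtain c where c: "mu \<in> comp_set c" "mu (E1, E1, E1) = 0 \<longrightarrow> c = C04 \<or> c = C06"
      using perm_struct_in_comp_set by blast
    have "c \<noteq> C04" "c \<noteq> C06" using rigid c(1) not_rigid_C04 not_rigid_C06 by blast+
    then have "c \<in> rigid_comps" "mu (E1, E1, E1) \<noteq> 0"
      using c(2) by (cases c; simp add: rigid_comps_def)+
    then have "mu \<in> orbit (witness c)" using c(1) by (simp add: orbit_witness)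
    then show "Q \<in> (\<lambda>c. orbit (witness c)) ` rigid_comps"
      using orbit_eq Q \<open>c \<in> rigid_comps\<close> by blast
  qed
qed

lemma card_rigid_orbits: "card {orbit mu | mu. rigid_in perm_variety mu} = 6"
proof -
  have "inj_on (\<lambda>c. orbit (witness c)) rigid_comps"
  proof (rule inj_onI)
    fix c d assume c: "c \<in> rigid_comps" and d: "d \<in> rigid_comps" "orbit (witness c) = orbit (witness d)"
    have "witness c \<in> comp_set d" using orbit_refl[of "witness c"] d by (simp add: orbit_witness)
    then show "c = d" using witness_iff by simp
  qed
  then show ?thesis unfolding rigid_orbits by (simp add: card_image rigid_comps_def)
qed

section \<open>Closures of the two one-parameter families\<close>

lemma orbit_R04_subset: "orbit (R04 a) \<subseteq> comp_set C04"
proof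
  fix nu assume "nu \<in> orbit (R04 a)"
  then obtain g h where nu: "nu = act g h (R04 a)"
    and g: "even_lin g" "mat_mul g h = mat_id" "mat_mul h g = mat_id"
    unfolding orbit_def by blast
  have "even_struct (R04 a)" unfolding even_struct_def all_idx by (simp add: R04_def)
  then have "even_struct nu" unfolding nu by (rule act_even[OF g])
  then show "nu \<in> comp_set C04"
    unfolding comp_set_def nu using inverse_entries[OF g]
    by (simp add: comp_defs act_def sum_idx R04_def)
qed

text \<open>The inner factor of the product is the pairing of y with x. In the orbit of
  \<open>R06 a\<close> both L and R are multiples of one such rank-one matrix, with pairing 0
  because h g = 1 has no off-diagonal entries.\<close>

lemma comp0_rank1:
  assumes "\<And>j k. X j k = c * (x j * y k)" and "\<And>j k. Y j k = d * (x j * y k)"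
    and "x E1 * y E1 + x F1 * y F1 + x F2 * y F2 = 0"
  shows "comp0 X Y"
  unfolding comp0_def
proof (intro allI)
  fix j k
  have "(\<Sum>m\<in>UNIV. X j m * Y m k) = c * d * x j * y k * (x E1 * y E1 + x F1 * y F1 + x F2 * y F2)"
    unfolding assms(1,2) sum_idx by (simp add: algebra_simps)
  then show "(\<Sum>m\<in>UNIV. X j m * Y m k) = 0" using assms(3) by simp
qed

lemma orbit_R06_subset: "orbit (R06 a) \<subseteq> comp_set C06"
proof
  fix nu assume "nu \<in> orbit (R06 a)"
  then obtain g h where nu: "nu = act g h (R06 a)"
    and g: "even_lin g" "mat_mul g h = mat_id" "mat_mul h g = mat_id"
    unfolding orbit_def by blast
  note inv = inverse_entries[OF g]
  have "even_struct (R06 a)" unfolding even_struct_def all_idx by (simp add: R06_def)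
  then have even: "even_struct nu" unfolding nu by (rule act_even[OF g])
  have left: "nu (E1, j, k) = h E1 E1 * (1 + a) * (h F1 j * g k F2)"
    and right: "nu (j, E1, k) = h E1 E1 * (1 - a) * (h F1 j * g k F2)" for j k
    unfolding nu by (simp_all add: act_def sum_idx R06_def inv)
  have orth: "h F1 E1 * g E1 F2 + h F1 F1 * g F1 F2 + h F1 F2 * g F2 F2 = 0" by (simp add: inv)
  note rank1 = comp0_rank1[where x="h F1" and y="\<lambda>k. g k F2"]
  have "comp0 (\<lambda>j m. nu (E1, j, m)) (\<lambda>j m. nu (E1, j, m))"
    "comp0 (\<lambda>j m. nu (j, E1, m)) (\<lambda>j m. nu (j, E1, m))"
    "comp0 (\<lambda>j m. nu (E1, j, m)) (\<lambda>j m. nu (j, E1, m))"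
    "comp0 (\<lambda>j m. nu (j, E1, m)) (\<lambda>j m. nu (E1, j, m))"
    by (rule rank1, rule left, rule left, rule orth, rule rank1, rule right, rule right, rule orth,
        rule rank1, rule left, rule right, rule orth, rule rank1, rule right, rule left, rule orth)
  moreover have "odd_prods_zero nu" "nu (E1, E1, E1) = 0"
    unfolding nu odd_prods_zero_def by (simp_all add: act_def sum_idx R06_def inv)
  ultimately have "comp_eqs C06 nu" by simp
  then show "nu \<in> comp_set C06" using even by (simp add: comp_set_def)
qed

lemma eq_paramI:
  assumes "mu \<in> comp_set C04" and "mu (F1, F1, E1) = t V1" "mu (F1, F2, E1) = t V2"
    "mu (F2, F1, E1) = t W1" "mu (F2, F2, E1) = t W2"
  shows "mu = param C04 t"
  unfolding param.simps using assms
  by (intro eq_mkI) (auto simp: comp_set_def comp_defs deg_eq_1)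

text \<open>Generic means that B11, the discriminant of the symmetric part and the skew part are
  nonzero. In the coordinates given by the two linear factors of the symmetric part only the two
  mixed values of B survive, and their ratio determines \<alpha>.\<close>

lemma zclosure_R04: "zclosure (\<Union>a. orbit (R04 a)) = comp_set C04"
proof
  show "zclosure (\<Union>a. orbit (R04 a)) \<subseteq> comp_set C04"
    using orbit_R04_subset by (intro zclosure_minimal zclosed_comp_set) blast
  let ?D = "\<lambda>t :: par \<Rightarrow> complex. (t V2 + t W1)\<^sup>2 - 4 * t V1 * t W2"
  let ?q = "\<lambda>t. t V1 * ?D t * (t V2 - t W1)"
  have in_orbit: "param C04 t \<in> (\<Union>a. orbit (R04 a))" if q: "?q t \<noteq> 0" for t
  proof -
    \<comment> \<open>The symmetric part of the form factors into the linear forms \<open>(2b, S + r)\<close> and \<open>(2b, S - r)\<close>.\<close>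
    define b where "b = t V1"
    define S where "S = t V2 + t W1"
    define c where "c = t V2 - t W1"
    define r where "r = csqrt (?D t)"
    \<comment> \<open>Matching the entry at (F1, F1) requires 8 k \<alpha> b b = b, and matching the
      skew part requires 2 k (-4 b r) = c; these two equations determine k and \<alpha>.\<close>
    define k where "k = - c / (8 * b * r)"
    define \<alpha> where "\<alpha> = - r / c"
    have rr: "r * r = S * S - 4 * b * t W2"
      unfolding r_def S_def b_def by (metis power2_csqrt power2_eq_square)
    have nz: "b \<noteq> 0" "c \<noteq> 0" "r \<noteq> 0" "k \<noteq> 0"
      using q by (auto simp: b_def c_def r_def k_def)
    have k\<alpha>: "k * \<alpha> = 1 / (8 * b)" using nz by (simp add: k_def \<alpha>_def)
    have kr: "k * (b * r) = - c / 8" using nz by (simp add: k_def)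
    define d where "d = - 4 * b * r"
    have d: "d \<noteq> 0" using nz by (simp add: d_def)
    define nu where "nu = act (blockmat k (mat2 ((S - r) / d) (- (S + r) / d) (- 2 * b / d) (2 * b / d)))
      (blockmat (1 / k) (mat2 (2 * b) (S + r) (2 * b) (S - r))) (R04 \<alpha>)"
    have det: "2 * b * (S - r) - 2 * b * (S + r) = d" by (simp add: d_def algebra_simps)
    have nu: "nu \<in> orbit (R04 \<alpha>)"
      unfolding nu_def
    proof (rule blockmat_act_in_orbit)
      show "k * (1 / k) = 1" using nz by simp
      show "(S - r) / d * (2 * b) + - (S + r) / d * (2 * b) = 1"
        "- 2 * b / d * (S + r) + 2 * b / d * (S - r) = 1"
        "2 * b * ((S - r) / d) + (S + r) * (- 2 * b / d) = 1"
        "2 * b * (- (S + r) / d) + (S - r) * (2 * b / d) = 1"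
        using d det by (simp_all add: divide_simps) (simp_all add: algebra_simps)
    qed (use d in \<open>simp_all add: divide_simps algebra_simps\<close>)
    have "nu (F1, F1, E1) = 8 * (k * \<alpha>) * (b * b)"
      by (simp add: nu_def act_def sum_idx blockmat_def R04_def algebra_simps)
    then have 11: "nu (F1, F1, E1) = t V1" using nz k\<alpha> by (simp add: b_def)
    have "nu (F1, F2, E1) = 4 * (k * \<alpha>) * (b * S) - 4 * (k * (b * r))"
      by (simp add: nu_def act_def sum_idx blockmat_def R04_def algebra_simps)
    also have "\<dots> = S / 2 + c / 2" unfolding k\<alpha> kr using nz by simp
    finally have 12: "nu (F1, F2, E1) = t V2"
      by (simp add: S_def c_def add_divide_distrib diff_divide_distrib)
    have "nu (F2, F1, E1) = 4 * (k * \<alpha>) * (b * S) + 4 * (k * (b * r))"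
      by (simp add: nu_def act_def sum_idx blockmat_def R04_def algebra_simps)
    also have "\<dots> = S / 2 - c / 2" unfolding k\<alpha> kr using nz by simp
    finally have 21: "nu (F2, F1, E1) = t W1"
      by (simp add: S_def c_def add_divide_distrib diff_divide_distrib)
    have "nu (F2, F2, E1) = 2 * (k * \<alpha>) * (S * S - r * r)"
      by (simp add: nu_def act_def sum_idx blockmat_def R04_def algebra_simps)
    then have 22: "nu (F2, F2, E1) = t W2" using nz k\<alpha> rr by simp
    have "nu = param C04 t"
      using nu orbit_R04_subset by (intro eq_paramI 11 12 21 22) blast
    then show ?thesis using nu by blast
  qed
  have q: "?q \<in> poly_fun" by (intro poly_fun_intros)
  show "comp_set C04 \<subseteq> zclosure (\<Union>a. orbit (R04 a))"
    unfolding range_param[symmetric]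
    by (rule range_subset_zclosure[OF poly_fun_param q, of "case_par 1 1 0 0"])
      (simp, rule in_orbit)
qed

text \<open>The factors of L and R are e (1 + \<alpha>) and e (1 - \<alpha>), whose sum 2 e is
  nonzero. Opposite factors therefore enter only through the closure.\<close>

lemma zclosure_R06: "zclosure (\<Union>a. orbit (R06 a)) = comp_set C06"
proof
  show "zclosure (\<Union>a. orbit (R06 a)) \<subseteq> comp_set C06"
    using orbit_R06_subset by (intro zclosure_minimal zclosed_comp_set) blast
  let ?q = "\<lambda>t :: par \<Rightarrow> complex. t V1 * (t W1 + t W2)"
  have in_orbit: "param C06 t \<in> (\<Union>a. orbit (R06 a))" if q: "?q t \<noteq> 0" for t
  proof -
    define p where "p = t V1"
    define e where "e = (t W1 + t W2) / 2"
    define \<alpha> where "\<alpha> = (t W1 - t W2) / 2 / e"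
    have nz: "p \<noteq> 0" "e \<noteq> 0" using q by (auto simp: p_def e_def)
    have "e * \<alpha> = (t W1 - t W2) / 2" using nz(2) by (simp add: \<alpha>_def)
    then have s: "e * (1 + \<alpha>) = t W1" "e * (1 - \<alpha>) = t W2"
      by (simp_all add: e_def distrib_left right_diff_distrib add_divide_distrib diff_divide_distrib)
    \<comment> \<open>Row \<open>F1\<close> of \<open>h\<close> is (V2, V1) and column
      \<open>F2\<close> of \<open>g\<close> is (V1, -V2), the row and column that make up
      \<open>nil\<close>. The other entries are chosen to make \<open>g\<close> and \<open>h\<close>
      inverse to each other.\<close>
    define g where "g = blockmat (1 / e) (mat2 0 p (1 / p) (- t V2))"
    define h where "h = blockmat e (mat2 (t V2) p (1 / p) 0)"
    define nu where "nu = act g h (R06 \<alpha>)"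
    have nu: "nu \<in> orbit (R06 \<alpha>)"
      unfolding nu_def g_def h_def by (rule blockmat_act_in_orbit) (use nz in simp_all)
    have left: "nu (E1, j, k) = t W1 * (h F1 j * g k F2)"
      and right: "nu (j, E1, k) = t W2 * (h F1 j * g k F2)" for j k
      unfolding s[symmetric] nu_def by (simp_all add: act_def sum_idx R06_def h_def blockmat_def)
    have entries: "h F1 F1 = t V2" "h F1 F2 = t V1" "g F1 F2 = t V1" "g F2 F2 = - t V2"
      by (simp_all add: g_def h_def p_def blockmat_def)
    have "nu \<in> comp_set C06" using nu orbit_R06_subset by blast
    then have "even_struct nu" "nu (E1, E1, E1) = 0" "odd_prods_zero nu" by (simp_all add: comp_set_def)
    then have "nu = param C06 t"
      unfolding param.simps
      by (intro eq_mkI) (auto simp: deg_eq_1 left right nil_def entries odd_prods_zero_def)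
    then show ?thesis using nu by (intro UN_I[of \<alpha>]) simp_all
  qed
  have q: "?q \<in> poly_fun" by (intro poly_fun_intros)
  show "comp_set C06 \<subseteq> zclosure (\<Union>a. orbit (R06 a))"
    unfolding range_param[symmetric]
    by (rule range_subset_zclosure[OF poly_fun_param q, of "\<lambda>_. 1"])
      (simp, rule in_orbit)
qed

section \<open>The dimension\<close>

definition coord_subspace :: "'a set \<Rightarrow> ('a \<Rightarrow> complex) set" where
  "coord_subspace J = {x. \<forall>i. i \<notin> J \<longrightarrow> x i = 0}"

lemma zirred_coord_subspace: "zirred (coord_subspace J)"
proof -
  define F where "F s = (\<lambda>i. if i \<in> J then s i else 0)" for s :: "'a \<Rightarrow> complex"
  have poly: "(\<lambda>s. F s i) \<in> poly_fun" for i
    by (cases "i \<in> J") (simp_all add: F_def poly_fun.intros)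
  have "zclosed (coord_subspace J)"
    unfolding coord_subspace_def by (intro zclosed_all zclosed_imp zclosed_eq poly_fun.intros)
  moreover have "coord_subspace J = range F"
  proof
    show "coord_subspace J \<subseteq> range F"
    proof
      fix x assume "x \<in> coord_subspace J"
      then have "x = F x" by (auto simp: coord_subspace_def F_def)
      then show "x \<in> range F" by (rule range_eqI[of x F x])
    qed
    show "range F \<subseteq> coord_subspace J" by (auto simp: coord_subspace_def F_def)
  qed
  ultimately show ?thesis using zirred_range[OF poly] by simp
qed

lemma coord_subspace_psubset:
  assumes "J \<subset> K"
  shows "coord_subspace J \<subset> coord_subspace K"
proof -
  obtain i where i: "i \<in> K" "i \<notin> J" using assms by blast
  have "(\<lambda>j. if j = i then 1 else 0) \<in> coord_subspace K - coord_subspace J"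
    using i by (auto simp: coord_subspace_def)
  moreover have "coord_subspace J \<subseteq> coord_subspace K"
    using assms by (auto simp: coord_subspace_def)
  ultimately show ?thesis by blast
qed

text \<open>The four entries of \<open>B\<close> are unconstrained in \<open>C04\<close>, so freeing
  them one at a time gives four strict inclusions of coordinate subspaces.\<close>

lemma krull_ge_C04: "krull_ge (comp_set C04) 4"
  unfolding krull_ge_def
proof (intro exI conjI allI impI)
  let ?l = "[(F1, F1, E1), (F1, F2, E1), (F2, F1, E1), (F2, F2, E1)]"
  let ?Z = "\<lambda>n. coord_subspace (set (take n ?l))"
  fix n :: nat
  show "zirred (?Z n)" by (rule zirred_coord_subspace)
  have "?Z n \<subseteq> coord_subspace (set ?l)"
    using set_take_subset[of n ?l] unfolding coord_subspace_def by blast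
  moreover have "coord_subspace (set ?l) \<subseteq> comp_set C04"
    unfolding comp_set_def coord_subspace_def even_struct_def all_idx by (auto simp: comp_defs)
  ultimately show "?Z n \<subseteq> comp_set C04" by blast
next
  let ?l = "[(F1, F1, E1), (F1, F2, E1), (F2, F1, E1), (F2, F2, E1)]"
  fix n :: nat assume n: "n < 4"
  then have "n = 0 \<or> n = 1 \<or> n = 2 \<or> n = 3" by arith
  then have "set (take n ?l) \<subset> set (take (Suc n) ?l)" by (elim disjE) (auto simp: eval_nat_numeral)
  then show "coord_subspace (set (take n ?l)) \<subset> coord_subspace (set (take (Suc n) ?l))"
    by (rule coord_subspace_psubset)
qed

lemma not_krull_ge_comp_set: "\<not> krull_ge (comp_set c) 5"
  using not_krull_ge_range[of "param c", OF poly_fun_param] by (simp add: card_par range_param)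

lemma variety_dim_perm_variety: "variety_dim_eq perm_variety 4"
  unfolding variety_dim_eq_def irr_components_perm_variety krull_dim_eq_def
proof (intro conjI ballI allI impI)
  have "krull_ge (comp_set C04) 4 \<and> \<not> krull_ge (comp_set C04) (Suc 4)"
    using krull_ge_C04 not_krull_ge_comp_set[of C04] by simp
  then show "\<exists>C\<in>range comp_set. krull_ge C 4 \<and> \<not> krull_ge C (Suc 4)" by blast
next
  fix C m assume "C \<in> range comp_set" and m: "krull_ge C m \<and> \<not> krull_ge C (Suc m)"
  then obtain c where "C = comp_set c" by blast
  then have "\<not> 5 \<le> m" using m not_krull_ge_comp_set[of c] krull_ge_mono[of C m 5] by blast
  then show "m \<le> 4" by simp
qed

theorem mainTheorem5:
  shows "variety_dim_eq perm_variety 4 \<and>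
    irr_components perm_variety =
      {zclosure (\<Union>a. orbit (R04 a)), zclosure (\<Union>a. orbit (R06 a)),
       zclosure (orbit R09), zclosure (orbit R15), zclosure (orbit R17),
       zclosure (orbit R19), zclosure (orbit R22), zclosure (orbit R24)} \<and>
    card (irr_components perm_variety) = 8 \<and>
    card {orbit mu | mu. rigid_in perm_variety mu} = 6"
proof (intro conjI)
  show "variety_dim_eq perm_variety 4" by (rule variety_dim_perm_variety)
  show "card {orbit mu | mu. rigid_in perm_variety mu} = 6" by (rule card_rigid_orbits)
  show "card (irr_components perm_variety) = 8"
    unfolding irr_components_perm_variety by (simp add: card_image inj_comp_set card_comp)
  have "zclosure (orbit R09) = comp_set C09" "zclosure (orbit R15) = comp_set C15"
    "zclosure (orbit R17) = comp_set C17" "zclosure (orbit R19) = comp_set C19"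
    "zclosure (orbit R22) = comp_set C22" "zclosure (orbit R24) = comp_set C24"
    using zclosure_orbit_witness unfolding rigid_comps_def by (metis insertCI witness.simps)+
  then show "irr_components perm_variety =
      {zclosure (\<Union>a. orbit (R04 a)), zclosure (\<Union>a. orbit (R06 a)),
       zclosure (orbit R09), zclosure (orbit R15), zclosure (orbit R17),
       zclosure (orbit R19), zclosure (orbit R22), zclosure (orbit R24)}"
    unfolding irr_components_perm_variety UNIV_comp by (simp add: zclosure_R04 zclosure_R06)
qed

end
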